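(* Let $G$ be a discrete amenable group acting by homeomorphisms on a compact metrizable space $X$. Then there is a $G$-invariant Borel probability measure $\mu$ on $X$ such that the sets of $\mu$-IE-tuples and IE-tuples coincide, that is, for every $k\ge1$ a tuple in $X^k$ is a $\mu$-IE-tuple if and only if it is an IE-tuple.
   Context: Limits. For finite $K\subseteq G$ and $\delta>0$, $M(K,\delta)$ is the set of nonempty finite $F\subseteq G$ with $|\{s\in F:Ks\subseteq F\}|\ge(1-\delta)|F|$. For a real-valued $\varphi$ on finite subsets of $G$, the limit supremum of $\varphi(F)/|F|$ as $F$ becomes more and more invariant is $\lim_{(K,\delta)}\sup_{F\in M(K,\delta)}\varphi(F)/|F|$, where $(K,\delta)\succ(K',\delta')$ if $K\supseteq K'$ and $\delta\le\delta'$; the limit infimum is defined with $\inf$, and the limit exists if they coincide. Independence. For a tuple $\boldsymbol A=(A_1,\dots,A_k)$ of subsets of $X$ and $D\subseteq X$, a set $J\subseteq G$ is an independence set for $\boldsymbol A$ relative to $D$ if $D\cap\bigcap_{s\in F}s^{-1}A_{\sigma(s)}\ne\emptyset$ for every nonempty finite $F\subseteq J$ and every $\sigma:F\to\{1,\dots,k\}$; it is an independence set for $\boldsymbol A$ if this holds with $D=X$. IE-tuples. $(x_1,\dots,x_k)\in X^k$ is an IE-tuple if for every product neighbourhood $U_1\times\cdots\times U_k$ of it, the limit of $\frac1{|F|}\max\{|F\cap J|:J\text{ is an independence set for }(U_1,\dots,U_k)\}$ as $F$ becomes more and more invariant (this limit exists) is positive. $\mu$-IE-tuples. Let $\mu$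 be a $G$-invariant Borel probability measure on $X$, let $\mathscr B(\mu,\delta)$ be the set of Borel $D\subseteq X$ with $\mu(D)\ge1-\delta$, and put $\varphi_{\boldsymbol A,\delta}(F)=\min_{D\in\mathscr B(\mu,\delta)}\max\{|F\cap J|:J\text{ is an independence set for }\boldsymbol A\text{ relative to }D\}$. $\overline{\mathrm I}_\mu(\boldsymbol A,\delta)$ is the limit supremum of $\varphi_{\boldsymbol A,\delta}(F)/|F|$ as $F$ becomes more and more invariant, and $\overline{\mathrm I}_\mu(\boldsymbol A)=\sup_{\delta>0}\overline{\mathrm I}_\mu(\boldsymbol A,\delta)$. $(x_1,\dots,x_k)\in X^k$ is a $\mu$-IE-tuple if $\overline{\mathrm I}_\mu((U_1,\dots,U_k))>0$ for every product neighbourhood $U_1\times\cdots\times U_k$ of it. *)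

theory Defs
  imports "HOL-Probability.Probability" "HOL-Algebra.Group_Action"
begin

text \<open>A discrete group is amenable if it carries a left-invariant finitely additive probability
  measure defined on all of its subsets.\<close>

definition amenable :: "('g, 'b) monoid_scheme \<Rightarrow> bool" where
  "amenable G \<longleftrightarrow> (\<exists>m :: 'g set \<Rightarrow> real.
     (\<forall>A. A \<subseteq> carrier G \<longrightarrow> 0 \<le> m A) \<and>
     m (carrier G) = 1 \<and>
     (\<forall>A B. A \<subseteq> carrier G \<and> B \<subseteq> carrier G \<and> A \<inter> B = {} \<longrightarrow> m (A \<union> B) = m A + m B) \<and>
     (\<forall>g A. g \<in> carrier G \<and> A \<subseteq> carrier G \<longrightarrow> m (g <#\<^bsub>G\<^esub> A) = m A))"

definition borel_of :: "'x topology \<Rightarrow> 'x measure" where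
  "borel_of X = sigma (topspace X) {U. openin X U}"

definition homeo_action ::
    "('g, 'b) monoid_scheme \<Rightarrow> 'x topology \<Rightarrow> ('g \<Rightarrow> 'x \<Rightarrow> 'x) \<Rightarrow> bool" where
  "homeo_action G X \<alpha> \<longleftrightarrow>
     group_action G (topspace X) \<alpha> \<and> (\<forall>g\<in>carrier G. homeomorphic_map X X (\<alpha> g))"

definition invariant_borel_prob ::
    "('g, 'b) monoid_scheme \<Rightarrow> 'x topology \<Rightarrow> ('g \<Rightarrow> 'x \<Rightarrow> 'x) \<Rightarrow> 'x measure \<Rightarrow> bool" where
  "invariant_borel_prob G X \<alpha> \<mu> \<longleftrightarrow>
     prob_space \<mu> \<and> sets \<mu> = sets (borel_of X) \<and>
     (\<forall>g\<in>carrier G. \<forall>B\<in>sets \<mu>. measure \<mu> {x \<in> topspace X. \<alpha> g x \<in> B} = measure \<mu> B)"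

definition inv_sets :: "('g, 'b) monoid_scheme \<Rightarrow> 'g set \<Rightarrow> real \<Rightarrow> 'g set set" where
  "inv_sets G K \<delta> = {F. finite F \<and> F \<noteq> {} \<and> F \<subseteq> carrier G \<and>
     real (card {s \<in> F. K #>\<^bsub>G\<^esub> s \<subseteq> F}) \<ge> (1 - \<delta>) * real (card F)}"

definition inv_params :: "('g, 'b) monoid_scheme \<Rightarrow> ('g set \<times> real) set" where
  "inv_params G = {(K, \<delta>). finite K \<and> K \<subseteq> carrier G \<and> 0 < \<delta>}"

text \<open>The filter of tails of the directed set of pairs, where \<open>(K', \<delta>')\<close> is beyond
  \<open>(K, \<delta>)\<close> if \<open>K \<subseteq> K'\<close> and \<open>\<delta>' \<le> \<delta>\<close>.\<close>

definition inv_net :: "('g, 'b) monoid_scheme \<Rightarrow> ('g set \<times> real) filter" where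
  "inv_net G = (INF (K, \<delta>)\<in>inv_params G.
     principal {(K', \<delta>'). (K', \<delta>') \<in> inv_params G \<and> K \<subseteq> K' \<and> \<delta>' \<le> \<delta>})"

text \<open>Suprema and infima are taken in the extended reals, so that they exist for every
  real-valued \<open>\<phi>\<close>.\<close>

definition inv_limsup :: "('g, 'b) monoid_scheme \<Rightarrow> ('g set \<Rightarrow> real) \<Rightarrow> ereal" where
  "inv_limsup G \<phi> =
     Lim (inv_net G) (\<lambda>(K, \<delta>). SUP F\<in>inv_sets G K \<delta>. ereal (\<phi> F / real (card F)))"

definition inv_liminf :: "('g, 'b) monoid_scheme \<Rightarrow> ('g set \<Rightarrow> real) \<Rightarrow> ereal" where
  "inv_liminf G \<phi> =
     Lim (inv_net G) (\<lambda>(K, \<delta>). INF F\<in>inv_sets G K \<delta>. ereal (\<phi> F / real (card F)))"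

definition has_inv_limit :: "('g, 'b) monoid_scheme \<Rightarrow> ('g set \<Rightarrow> real) \<Rightarrow> ereal \<Rightarrow> bool" where
  "has_inv_limit G \<phi> L \<longleftrightarrow> inv_limsup G \<phi> = L \<and> inv_liminf G \<phi> = L"

text \<open>A \<open>k\<close>-tuple is a function on \<open>{1..k}\<close>; for tuples of sets only the values
  there are relevant.\<close>

definition indep_set :: "('g, 'b) monoid_scheme \<Rightarrow> 'x topology \<Rightarrow> ('g \<Rightarrow> 'x \<Rightarrow> 'x) \<Rightarrow>
    nat \<Rightarrow> (nat \<Rightarrow> 'x set) \<Rightarrow> 'x set \<Rightarrow> 'g set \<Rightarrow> bool" where
  "indep_set G X \<alpha> k A D J \<longleftrightarrow> J \<subseteq> carrier G \<and>
     (\<forall>F \<sigma>. finite F \<and> F \<noteq> {} \<and> F \<subseteq> J \<and> \<sigma> \<in> F \<rightarrow> {1..k} \<longrightarrow>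
        D \<inter> (\<Inter>s\<in>F. {x \<in> topspace X. \<alpha> s x \<in> A (\<sigma> s)}) \<noteq> {})"

definition max_indep :: "('g, 'b) monoid_scheme \<Rightarrow> 'x topology \<Rightarrow> ('g \<Rightarrow> 'x \<Rightarrow> 'x) \<Rightarrow>
    nat \<Rightarrow> (nat \<Rightarrow> 'x set) \<Rightarrow> 'x set \<Rightarrow> 'g set \<Rightarrow> nat" where
  "max_indep G X \<alpha> k A D F = Max {card (F \<inter> J) | J. indep_set G X \<alpha> k A D J}"

definition product_nbhd ::
    "'x topology \<Rightarrow> nat \<Rightarrow> (nat \<Rightarrow> 'x) \<Rightarrow> (nat \<Rightarrow> 'x set) \<Rightarrow> bool" where
  "product_nbhd X k x U \<longleftrightarrow>
     (\<forall>i\<in>{1..k}. U i \<subseteq> topspace X \<and> (\<exists>V. openin X V \<and> x i \<in> V \<and> V \<subseteq> U i))"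

definition IE_tuples :: "('g, 'b) monoid_scheme \<Rightarrow> 'x topology \<Rightarrow> ('g \<Rightarrow> 'x \<Rightarrow> 'x) \<Rightarrow>
    nat \<Rightarrow> (nat \<Rightarrow> 'x) set" where
  "IE_tuples G X \<alpha> k = {x \<in> {1..k} \<rightarrow>\<^sub>E topspace X. \<forall>U. product_nbhd X k x U \<longrightarrow>
     (\<exists>L>0. has_inv_limit G (\<lambda>F. real (max_indep G X \<alpha> k U (topspace X) F)) L)}"

definition large_sets :: "'x measure \<Rightarrow> real \<Rightarrow> 'x set set" where
  "large_sets \<mu> \<delta> = {D \<in> sets \<mu>. measure \<mu> D \<ge> 1 - \<delta>}"

definition mu_indep :: "('g, 'b) monoid_scheme \<Rightarrow> 'x topology \<Rightarrow> ('g \<Rightarrow> 'x \<Rightarrow> 'x) \<Rightarrow> 'x measure \<Rightarrow>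
    nat \<Rightarrow> (nat \<Rightarrow> 'x set) \<Rightarrow> real \<Rightarrow> 'g set \<Rightarrow> nat" where
  "mu_indep G X \<alpha> \<mu> k A \<delta> F = Min ((\<lambda>D. max_indep G X \<alpha> k A D F) ` large_sets \<mu> \<delta>)"

definition upper_mu_density_at :: "('g, 'b) monoid_scheme \<Rightarrow> 'x topology \<Rightarrow> ('g \<Rightarrow> 'x \<Rightarrow> 'x) \<Rightarrow>
    'x measure \<Rightarrow> nat \<Rightarrow> (nat \<Rightarrow> 'x set) \<Rightarrow> real \<Rightarrow> ereal" where
  "upper_mu_density_at G X \<alpha> \<mu> k A \<delta> = inv_limsup G (\<lambda>F. real (mu_indep G X \<alpha> \<mu> k A \<delta> F))"

definition upper_mu_density :: "('g, 'b) monoid_scheme \<Rightarrow> 'x topology \<Rightarrow> ('g \<Rightarrow> 'x \<Rightarrow> 'x) \<Rightarrow>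
    'x measure \<Rightarrow> nat \<Rightarrow> (nat \<Rightarrow> 'x set) \<Rightarrow> ereal" where
  "upper_mu_density G X \<alpha> \<mu> k A = (SUP \<delta>\<in>{0<..}. upper_mu_density_at G X \<alpha> \<mu> k A \<delta>)"

definition mu_IE_tuples :: "('g, 'b) monoid_scheme \<Rightarrow> 'x topology \<Rightarrow> ('g \<Rightarrow> 'x \<Rightarrow> 'x) \<Rightarrow>
    'x measure \<Rightarrow> nat \<Rightarrow> (nat \<Rightarrow> 'x) set" where
  "mu_IE_tuples G X \<alpha> \<mu> k = {x \<in> {1..k} \<rightarrow>\<^sub>E topspace X.
     \<forall>U. product_nbhd X k x U \<longrightarrow> upper_mu_density G X \<alpha> \<mu> k U > 0}"

end

theory Submission
  imports Defs
begin

text \<open>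
  Every \<open>\<mu>\<close>-IE-tuple is an IE-tuple, because a large set \<open>D\<close> only makes independence relative to \<open>D\<close>
  harder. The task is to find one invariant measure for which the converse holds.

  Fix a tuple \<open>A\<close> of sets whose independence density \<open>L\<close> is positive, and let \<open>F\<close> be a very invariant
  finite set with an independence set \<open>J \<subseteq> F\<close> of size at least \<open>L * card F\<close>. Choose a point \<open>x \<sigma>\<close> for each
  colouring \<open>\<sigma>\<close> of \<open>J\<close> that realizes this colouring, and consider the distribution of \<open>\<alpha> s (x \<sigma>)\<close> where \<open>s \<in> F\<close>
  and \<open>\<sigma>\<close> are uniformly random. It is almost invariant. If a set \<open>V\<close> has nearly full mass and \<open>E\<close> is any
  finite set, then for some \<open>s\<close> the translate of \<open>E\<close> by \<open>s\<close> contains a proportion \<open>L / 2\<close> of points of \<open>J\<close>, while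
  \<open>\<alpha> s (x \<sigma>)\<close> lies in \<open>V\<close> for nearly all colourings (\<open>many_good_translates\<close>). By a Sauer--Shelah argument
  for \<open>k\<close> colours (\<open>large_shattered_subset\<close>) these colourings shatter a fixed proportion of the points,
  and this gives a subset of \<open>E\<close> of proportional size that is independent relative to \<open>V\<close>
  (\<open>indep_subset_of_sample\<close>).

  A cluster point of these distributions, as functions on all subsets of the space, is an invariant
  finitely additive probability with the same property (\<open>exists_mean_detecting_indep\<close>). A mixture with
  positive weights of such means, one for every tuple from a countable family of closed sets, has the
  property for all these tuples at once (\<open>detects_indep_mixture\<close>).

  A finitely additive probability \<open>m\<close> on a compact normal space yields a regular Borel probability
  measure \<open>\<mu>\<close>, invariant if \<open>m\<close> is, with \<open>\<mu> V \<le> m V\<close> for open \<open>V\<close>. A Borel set of large measure thus contains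
  a closed set \<open>C\<close> whose open neighbourhoods are all large for \<open>m\<close> (\<open>closed_inside\<close>). For a tuple of closed
  sets, independence relative to all neighbourhoods of \<open>C\<close> passes to \<open>C\<close> itself
  (\<open>indep_from_neighbourhoods\<close>), and this is the positivity that is wanted for \<open>\<mu>\<close>.

  That the limit in the definition of IE-tuples exists is shown directly: the size of a maximal
  independence set in \<open>F\<close> relative to \<open>card F\<close> is asymptotically bounded by the corresponding ratio for
  any fixed finite \<open>K\<close> (\<open>max_indep_ratio_le\<close>), so the limit is the infimum of these ratios.
\<close>

section \<open>Shattered sets of coordinates\<close>

definition shatters :: "('a \<Rightarrow> 'c) set \<Rightarrow> 'c set \<Rightarrow> 'a set \<Rightarrow> bool" where
  "shatters S C J \<longleftrightarrow> (\<forall>\<tau>\<in>J \<rightarrow>\<^sub>E C. \<exists>\<sigma>\<in>S. restrict \<sigma> J = \<tau>)"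

lemma shatters_empty: "S \<noteq> {} \<Longrightarrow> shatters S C {}"
  by (auto simp: shatters_def restrict_def)

text \<open>The Sauer--Shelah bound for more than two colours, in exponential form. Remove one coordinate
  \<open>a\<close>, and let \<open>P\<close> be the set of colourings left, and \<open>Q\<close> the set of those that extend by all colours.
  Every element of \<open>P - Q\<close> misses a colour, so \<open>card S \<le> (card C - 1) * card P + card Q\<close>. What \<open>Q\<close>
  shatters, \<open>S\<close> shatters together with \<open>a\<close>, so the bound for \<open>Q\<close> gains a factor \<open>1/4\<close>, and
  \<open>card C - 1 + 1/4 = card C - 3/4\<close>. Any \<open>t \<ge> 1\<close> in place of \<open>4\<close> would do here, with base
  \<open>card C - 1 + 1/t\<close>; the value \<open>4\<close> keeps this base below the \<open>card C - 1/2\<close> that is met later.\<close>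
lemma card_le_if_shatters_small:
  fixes S :: "('a \<Rightarrow> 'c) set" and C :: "'c set"
  assumes "finite I" "finite C" "C \<noteq> {}" "S \<subseteq> I \<rightarrow>\<^sub>E C"
    and "\<And>J. J \<subseteq> I \<Longrightarrow> shatters S C J \<Longrightarrow> card J \<le> m"
  shows "real (card S) \<le> 4 ^ m * (real (card C) - 3/4) ^ card I"
  using assms(1,4,5)
proof (induction I arbitrary: S m rule: finite_induct)
  case empty
  have "card S \<le> card {\<lambda>x::'a. undefined::'c}"
    using empty.prems(1) by (intro card_mono) auto
  then have "real (card S) \<le> 1" by simp
  also have "1 \<le> (4::real) ^ m" by simp
  finally show ?case by simp
next
  case (insert a I)
  define P where "P = (\<lambda>\<sigma>. restrict \<sigma> I) ` S"
  define Q where "Q = {p \<in> I \<rightarrow>\<^sub>E C. \<forall>c\<in>C. p(a := c) \<in> S}"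
  have k1: "card C \<ge> 1" using assms(2,3) by (simp add: Suc_leI card_gt_0_iff)
  have finS: "finite S" using insert.prems(1) insert.hyps(1) assms(2)
    by (meson finite_PiE finite_insert finite_subset)
  have finP: "finite P" using finS by (simp add: P_def)
  have finQ: "finite Q" using insert.hyps(1) assms(2) by (simp add: Q_def finite_PiE)
  have P_sub: "P \<subseteq> I \<rightarrow>\<^sub>E C" using insert.prems(1) by (force simp: P_def PiE_def Pi_def)
  have QP: "Q \<subseteq> P"
  proof
    fix p assume p: "p \<in> Q"
    obtain c where "c \<in> C" using assms(3) by blast
    then have "p(a := c) \<in> S" using p by (simp add: Q_def)
    moreover have "restrict (p(a := c)) I = p"
    proof
      fix x show "restrict (p(a := c)) I x = p x"
        using p insert.hyps(2) by (cases "x \<in> I") (auto simp: Q_def PiE_def extensional_def)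
    qed
    ultimately show "p \<in> P" unfolding P_def by (metis imageI)
  qed
  define fib where "fib p = {\<sigma> \<in> S. restrict \<sigma> I = p}" for p
  have fib_inj: "inj_on (\<lambda>\<sigma>. \<sigma> a) (fib p)" for p
  proof (rule inj_onI)
    fix \<sigma> \<tau> assume h: "\<sigma> \<in> fib p" "\<tau> \<in> fib p" "\<sigma> a = \<tau> a"
    show "\<sigma> = \<tau>"
    proof
      fix x
      consider "x = a" | "x \<in> I" | "x \<notin> insert a I" by blast
      then show "\<sigma> x = \<tau> x"
      proof cases
        case 2
        then show ?thesis using h by (auto simp: fib_def dest!: fun_cong[where x = x])
      next
        case 3
        have "\<sigma> \<in> insert a I \<rightarrow>\<^sub>E C" "\<tau> \<in> insert a I \<rightarrow>\<^sub>E C"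
          using h insert.prems(1) by (auto simp: fib_def)
        then show ?thesis using 3 by (simp add: PiE_def extensional_def)
      qed (use h in simp)
    qed
  qed
  have fib_img: "(\<lambda>\<sigma>. \<sigma> a) ` fib p \<subseteq> C" for p
    using insert.prems(1) by (auto simp: fib_def PiE_def Pi_def)
  have fib_C: "card (fib p) \<le> card C" for p
    using card_inj_on_le[OF fib_inj fib_img assms(2)] .
  have upd: "\<sigma> = p(a := \<sigma> a)" if "\<sigma> \<in> fib p" for \<sigma> p
  proof
    fix x
    have e: "\<sigma> \<in> insert a I \<rightarrow>\<^sub>E C" "p = restrict \<sigma> I" using that insert.prems(1) by (auto simp: fib_def)
    show "\<sigma> x = (p(a := \<sigma> a)) x"
      using e by (auto simp: PiE_def extensional_def restrict_def)
  qed
  have fib_lt: "card (fib p) \<le> card C - 1" if pQ: "p \<in> P - Q" for p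
  proof -
    obtain c where c: "c \<in> C" "p(a := c) \<notin> S" using pQ P_sub unfolding Q_def by blast
    have "(\<lambda>\<sigma>. \<sigma> a) ` fib p \<subseteq> C - {c}"
    proof (rule image_subsetI)
      fix \<sigma> assume s: "\<sigma> \<in> fib p"
      then have "\<sigma> \<in> S" by (simp add: fib_def)
      then have "\<sigma> a \<noteq> c" using upd[OF s] c(2) by metis
      then show "\<sigma> a \<in> C - {c}" using fib_img s by blast
    qed
    from card_inj_on_le[OF fib_inj this] assms(2) c(1) show ?thesis by simp
  qed
  have "S = (\<Union>p\<in>P. fib p)" by (auto simp: P_def fib_def)
  then have "card S \<le> (\<Sum>p\<in>P. card (fib p))" using card_UN_le[OF finP, of fib] by simp
  also have "\<dots> = (\<Sum>p\<in>P - Q. card (fib p)) + (\<Sum>p\<in>Q. card (fib p))"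
    using sum.subset_diff[OF QP finP] by blast
  also have "\<dots> \<le> (\<Sum>p\<in>P - Q. card C - 1) + (\<Sum>p\<in>Q. card C)"
    using fib_lt fib_C by (intro add_mono sum_mono) auto
  also have "\<dots> = (card C - 1) * card (P - Q) + card C * card Q" by simp
  also have "\<dots> = (card C - 1) * card P + card Q"
  proof -
    have "card P = card (P - Q) + card Q"
      using card_Diff_subset[OF finQ QP] card_mono[OF finP QP] by linarith
    moreover obtain k' where "card C = Suc k'" using k1 by (cases "card C") auto
    ultimately show ?thesis by (simp only: add_mult_distrib2 diff_Suc_1 mult_Suc)
  qed
  finally have "real (card S) \<le> real ((card C - 1) * card P + card Q)" by linarith
  then have main: "real (card S) \<le> (real (card C) - 1) * real (card P) + real (card Q)"
    using k1 by (simp add: of_nat_diff)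
  define b where "b = real (card C) - 3/4"
  have b: "b \<ge> 0" using k1 by (simp add: b_def)
  have "real (card P) \<le> 4 ^ m * b ^ card I"
    unfolding b_def
  proof (rule insert.IH[OF P_sub])
    fix J assume J: "J \<subseteq> I" "shatters P C J"
    have "shatters S C J"
      unfolding shatters_def
    proof
      fix \<tau> assume "\<tau> \<in> J \<rightarrow>\<^sub>E C"
      then obtain \<sigma> where "\<sigma> \<in> S" "restrict (restrict \<sigma> I) J = \<tau>"
        using J(2) by (auto simp: shatters_def P_def)
      then show "\<exists>\<sigma>\<in>S. restrict \<sigma> J = \<tau>" using J(1) by (auto simp: Int_absorb1)
    qed
    then show "card J \<le> m" using insert.prems(2) J(1) by blast
  qed
  then have P_le: "(real (card C) - 1) * real (card P) \<le> (real (card C) - 1) * (4 ^ m * b ^ card I)"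
    using k1 by (intro mult_left_mono) auto
  have Sh: "card J + 1 \<le> m" if J: "J \<subseteq> I" "shatters Q C J" for J
  proof -
    have "shatters S C (insert a J)"
      unfolding shatters_def
    proof
      fix \<tau> assume t: "\<tau> \<in> insert a J \<rightarrow>\<^sub>E C"
      have "a \<notin> J" using J(1) insert.hyps(2) by blast
      then have "restrict \<tau> J \<in> J \<rightarrow>\<^sub>E C" using t by auto
      then obtain q where q: "q \<in> Q" "restrict q J = restrict \<tau> J"
        using J(2) unfolding shatters_def by blast
      have "q(a := \<tau> a) \<in> S" using q(1) t by (auto simp: Q_def)
      moreover have "restrict (q(a := \<tau> a)) (insert a J) = \<tau>"
      proof
        fix x show "restrict (q(a := \<tau> a)) (insert a J) x = \<tau> x"
          using t fun_cong[OF q(2), of x] by (auto simp: restrict_def PiE_def extensional_def)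
      qed
      ultimately show "\<exists>\<sigma>\<in>S. restrict \<sigma> (insert a J) = \<tau>" by blast
    qed
    then have "card (insert a J) \<le> m" using insert.prems(2) J(1) by blast
    moreover have "finite J" "a \<notin> J" using J(1) insert.hyps by (auto intro: finite_subset)
    ultimately show ?thesis by simp
  qed
  have Q_le: "real (card Q) \<le> (1/4) * (4 ^ m * b ^ card I)"
  proof (cases "Q = {}")
    case False
    then have "shatters Q C {}" by (rule shatters_empty)
    from Sh[OF _ this] have m: "m \<ge> 1" by simp
    have "real (card Q) \<le> 4 ^ (m - 1) * b ^ card I"
      unfolding b_def
    proof (rule insert.IH)
      show "Q \<subseteq> I \<rightarrow>\<^sub>E C" by (auto simp: Q_def)
      show "card J \<le> m - 1" if "J \<subseteq> I" "shatters Q C J" for J using Sh[OF that] by simp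
    qed
    also have "(4::real) ^ (m - 1) = (1/4) * 4 ^ m" using m by (cases m) auto
    finally show ?thesis by simp
  qed (use b in simp)
  have "real (card S) \<le> (real (card C) - 1) * (4 ^ m * b ^ card I) + (1/4) * (4 ^ m * b ^ card I)"
    using main P_le Q_le by linarith
  also have "\<dots> = 4 ^ m * b ^ card (insert a I)"
    using insert.hyps by (simp add: b_def algebra_simps)
  finally show ?case by (simp add: b_def)
qed

text \<open>A lower bound for the proportion of coordinates in a largest set shattered by at least a
  fraction \<open>1 - 1/(2k)\<close> of all colourings with \<open>k\<close> colours.\<close>
definition shatter_density :: "nat \<Rightarrow> real" where
  "shatter_density k = log 4 ((real k - 1/2) / (real k - 3/4))"

lemma shatter_density_pos: "k \<ge> 1 \<Longrightarrow> shatter_density k > 0"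
  unfolding shatter_density_def by (subst zero_less_log_cancel_iff) (auto simp: field_simps)

text \<open>An arbitrary positive fraction of all colourings shatters linearly many coordinates only up to an
  additive constant, which is useless for small \<open>I\<close> and hence for finite groups. The fraction
  \<open>1 - 1/(2k)\<close> avoids this: for nonempty \<open>I\<close> it amounts to at least \<open>(k - 1/2) ^ card I\<close> colourings, and comparing with
  \<open>4 ^ m * (k - 3/4) ^ card I\<close> gives a lower bound for \<open>m\<close> that is linear in \<open>card I\<close>.\<close>
lemma large_shattered_subset:
  fixes S :: "('a \<Rightarrow> 'c) set"
  assumes I: "finite I" and C: "finite C" "C \<noteq> {}" and S: "S \<subseteq> I \<rightarrow>\<^sub>E C"
    and big: "real (card S) \<ge> (1 - 1 / (2 * real (card C))) * real (card C) ^ card I"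
  shows "\<exists>J\<subseteq>I. shatters S C J \<and> real (card J) \<ge> shatter_density (card C) * real (card I)"
proof -
  define k where "k = card C"
  have k: "k \<ge> 1" using C by (simp add: k_def Suc_leI card_gt_0_iff)
  have pos: "real (card S) > 0"
  proof -
    have "(1 - 1 / (2 * real k)) * real k ^ card I > 0" using k by (simp add: field_simps)
    then show ?thesis using big by (simp add: k_def)
  qed
  then have "S \<noteq> {}" by auto
  then have sh0: "shatters S C {}" by (rule shatters_empty)
  define \<J> where "\<J> = {J. J \<subseteq> I \<and> shatters S C J}"
  have fin: "finite \<J>" using I by (simp add: \<J>_def)
  have ne: "\<J> \<noteq> {}" using sh0 by (auto simp: \<J>_def)
  define m where "m = Max (card ` \<J>)"
  obtain J where J: "J \<in> \<J>" "card J = m"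
    using Max_in[of "card ` \<J>"] fin ne unfolding m_def by fastforce
  have le: "real (card S) \<le> 4 ^ m * (real k - 3/4) ^ card I"
    unfolding k_def
  proof (rule card_le_if_shatters_small[OF I C S])
    show "card J \<le> m" if "J \<subseteq> I" "shatters S C J" for J
      unfolding m_def using that fin by (intro Max_ge) (auto simp: \<J>_def)
  qed
  have "real (card J) \<ge> shatter_density k * real (card I)"
  proof (cases "card I = 0")
    case False
    then obtain n where n: "card I = Suc n" by (cases "card I") auto
    have "(real k - 1/2) ^ Suc n = (1 - 1 / (2 * real k)) * (real k * (real k - 1/2) ^ n)"
      using k by (simp add: field_simps)
    also have "\<dots> \<le> (1 - 1 / (2 * real k)) * (real k * real k ^ n)"
      using k by (intro mult_left_mono power_mono) (auto simp: field_simps)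
    also have "\<dots> \<le> real (card S)" using big n by (simp add: k_def)
    also have "\<dots> \<le> 4 ^ m * (real k - 3/4) ^ Suc n" using le n by simp
    finally have "((real k - 1/2) / (real k - 3/4)) ^ card I \<le> 4 ^ m"
      using k n by (simp add: power_divide pos_divide_le_eq del: power_Suc)
    then have "log 4 (((real k - 1/2) / (real k - 3/4)) ^ card I) \<le> log 4 (4 ^ m)"
      using k by (subst log_le_cancel_iff) (auto simp: field_simps)
    then show ?thesis using k J(2)
      by (simp add: log_nat_power shatter_density_def mult.commute)
  qed simp
  then show ?thesis using J(1) by (auto simp: \<J>_def k_def)
qed

section \<open>Borel measures from finitely additive probabilities\<close>

locale fin_add_prob =
  fixes \<Omega> :: "'x set" and m :: "'x set \<Rightarrow> real"
  assumes nonneg: "B \<subseteq> \<Omega> \<Longrightarrow> 0 \<le> m B"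
    and total: "m \<Omega> = 1"
    and add: "B \<subseteq> \<Omega> \<Longrightarrow> C \<subseteq> \<Omega> \<Longrightarrow> B \<inter> C = {} \<Longrightarrow> m (B \<union> C) = m B + m C"
begin

lemma empty: "m {} = 0"
  using add[of "{}" "{}"] by simp

lemma mono:
  assumes "B \<subseteq> C" "C \<subseteq> \<Omega>" shows "m B \<le> m C"
proof -
  have "B \<subseteq> \<Omega>" "C - B \<subseteq> \<Omega>" "B \<union> (C - B) = C" using assms by auto
  then show ?thesis using add[of B "C - B"] nonneg[of "C - B"] by auto
qed

lemma Compl: "B \<subseteq> \<Omega> \<Longrightarrow> m (\<Omega> - B) = 1 - m B"
  using add[of B "\<Omega> - B"] total by (auto simp: Un_absorb1)

lemma Un_le:
  assumes "B \<subseteq> \<Omega>" "C \<subseteq> \<Omega>" shows "m (B \<union> C) \<le> m B + m C"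
proof -
  have "C - B \<subseteq> \<Omega>" "B \<union> (C - B) = B \<union> C" using assms by auto
  then show ?thesis using add[of B "C - B"] mono[of "C - B" C] assms by auto
qed

lemma le_1: "B \<subseteq> \<Omega> \<Longrightarrow> m B \<le> 1"
  using mono[of B \<Omega>] total by simp

end

locale fin_add_prob_on_compact = fin_add_prob "topspace X" m
  for X :: "'x topology" and m +
  assumes compact: "compact_space X" and normal: "normal_space X"
begin

text \<open>The two steps of Riesz's construction of a Borel measure, with a finitely additive
  probability in place of a positive functional: open sets are measured from inside by closed sets,
  and arbitrary sets from outside by open sets. The result need not agree with \<open>m\<close>, which
  may fail to be countably additive; what remains is \<open>inner_content V \<le> ennreal (m V)\<close> for open \<open>V\<close>.\<close>
definition inner_content :: "'x set \<Rightarrow> ennreal" where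
  "inner_content V = (SUP K\<in>{K. closedin X K \<and> K \<subseteq> V}. ennreal (m K))"

definition outer :: "'x set \<Rightarrow> ennreal" where
  "outer E = (INF V\<in>{V. openin X V \<and> E \<subseteq> V}. inner_content V)"

definition regular_measure :: "'x measure" where
  "regular_measure = measure_of (topspace X) {U. openin X U} outer"

lemma closed_le_inner: "closedin X K \<Longrightarrow> K \<subseteq> V \<Longrightarrow> ennreal (m K) \<le> inner_content V"
  unfolding inner_content_def by (rule SUP_upper) simp

lemma inner_leI:
  "(\<And>K. closedin X K \<Longrightarrow> K \<subseteq> V \<Longrightarrow> ennreal (m K) \<le> b) \<Longrightarrow> inner_content V \<le> b"
  unfolding inner_content_def by (rule SUP_least) simp

lemma inner_mono: "V \<subseteq> W \<Longrightarrow> inner_content V \<le> inner_content W"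
  by (intro inner_leI closed_le_inner) auto

lemma inner_le: "V \<subseteq> topspace X \<Longrightarrow> inner_content V \<le> ennreal (m V)"
  by (intro inner_leI ennreal_leI mono)

lemma inner_empty: "inner_content {} = 0"
  using inner_le[of "{}"] empty by simp

text \<open>By normality, a closed set in \<open>V \<union> W\<close> is the union of two closed sets, one in \<open>V\<close> and one
  in \<open>W\<close>.\<close>
lemma inner_Un:
  assumes "openin X V" "openin X W"
  shows "inner_content (V \<union> W) \<le> inner_content V + inner_content W"
proof (rule inner_leI)
  fix K assume K: "closedin X K" "K \<subseteq> V \<union> W"
  have "closedin X (K - V)" "closedin X (K - W)"
    using K assms by (auto intro: closedin_diff)
  moreover have "disjnt (K - V) (K - W)" using K by (auto simp: disjnt_def)
  ultimately obtain S T where ST: "openin X S" "openin X T" "K - V \<subseteq> S" "K - W \<subseteq> T" "disjnt S T"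
    using normal unfolding normal_space_def by metis
  have cl: "closedin X (K - S)" "closedin X (K - T)"
    using K ST by (auto intro: closedin_diff)
  have "K = (K - S) \<union> (K - T)" using ST by (auto simp: disjnt_def)
  then have "m K \<le> m (K - S) + m (K - T)"
    using Un_le[of "K - S" "K - T"] cl[THEN closedin_subset] by metis
  then have "ennreal (m K) \<le> ennreal (m (K - S)) + ennreal (m (K - T))"
    using nonneg cl[THEN closedin_subset] by (simp add: ennreal_leI flip: ennreal_plus)
  also have "\<dots> \<le> inner_content V + inner_content W"
    using ST cl by (intro add_mono closed_le_inner) auto
  finally show "ennreal (m K) \<le> inner_content V + inner_content W" .
qed

lemma inner_UN_finite:
  assumes "finite N" "\<And>i. openin X (V i)"
  shows "inner_content (\<Union>i\<in>N. V i) \<le> (\<Sum>i\<in>N. inner_content (V i))"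
  using assms(1)
proof (induction N rule: finite_induct)
  case (insert j N)
  have "inner_content (\<Union>i\<in>insert j N. V i) \<le> inner_content (V j) + inner_content (\<Union>i\<in>N. V i)"
    using inner_Un[of "V j" "\<Union>i\<in>N. V i"] assms(2) by auto
  also have "\<dots> \<le> inner_content (V j) + (\<Sum>i\<in>N. inner_content (V i))"
    using insert.IH by (rule add_left_mono)
  finally show ?case using insert.hyps by simp
qed (simp add: inner_empty)

text \<open>Compactness turns finite subadditivity into countable subadditivity: a closed set in the union
  already lies in finitely many of the open sets.\<close>
lemma inner_UN:
  assumes "\<And>i::nat. openin X (V i)"
  shows "inner_content (\<Union>i. V i) \<le> (\<Sum>i. inner_content (V i))"
proof (rule inner_leI)
  fix K assume K: "closedin X K" "K \<subseteq> (\<Union>i. V i)"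
  then have "compactin X K" using compact by (simp add: closedin_compact_space)
  then obtain \<F> where \<F>: "finite \<F>" "\<F> \<subseteq> range V" "K \<subseteq> \<Union>\<F>"
    unfolding compactin_def using K assms by (metis (no_types, lifting) rangeE)
  obtain N where N: "finite N" "\<F> = V ` N"
    using finite_subset_image[OF \<F>(1,2)] by blast
  have "ennreal (m K) \<le> inner_content (\<Union>i\<in>N. V i)"
    using K \<F> N by (intro closed_le_inner) auto
  also have "\<dots> \<le> (\<Sum>i\<in>N. inner_content (V i))" using N assms by (intro inner_UN_finite)
  also have "\<dots> \<le> (\<Sum>i. inner_content (V i))" using N by (intro sum_le_suminf) auto
  finally show "ennreal (m K) \<le> (\<Sum>i. inner_content (V i))" .
qed

lemma outer_le: "openin X V \<Longrightarrow> E \<subseteq> V \<Longrightarrow> outer E \<le> inner_content V"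
  unfolding outer_def by (rule INF_lower) simp

lemma outer_geI:
  "(\<And>V. openin X V \<Longrightarrow> E \<subseteq> V \<Longrightarrow> b \<le> inner_content V) \<Longrightarrow> b \<le> outer E"
  unfolding outer_def by (rule INF_greatest) simp

lemma outer_mono: "E \<subseteq> F \<Longrightarrow> outer E \<le> outer F"
  by (intro outer_geI outer_le) auto

lemma outer_open: "openin X V \<Longrightarrow> outer V = inner_content V"
  by (intro antisym outer_le outer_geI inner_mono) auto

lemma outer_measure_space: "outer_measure_space (Pow (topspace X)) outer"
  unfolding outer_measure_space_def
proof (intro conjI)
  show "positive (Pow (topspace X)) outer"
    by (simp add: positive_def outer_open inner_empty)
  show "increasing (Pow (topspace X)) outer"
    by (simp add: increasing_def outer_mono)
  show "countably_subadditive (Pow (topspace X)) outer"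
    unfolding countably_subadditive_def
  proof (intro allI impI)
    fix A :: "nat \<Rightarrow> 'x set"
    show "outer (\<Union>i. A i) \<le> (\<Sum>i. outer (A i))"
    proof (rule ennreal_le_epsilon)
      fix e :: real assume e: "0 < e" and fin: "(\<Sum>i. outer (A i)) < Orderings.top"
      have "outer (A i) < outer (A i) + e * (1/2) ^ Suc i" for i
        using e fin by (auto simp add: less_top dest!: ennreal_suminf_lessD)
      then have "\<exists>V. openin X V \<and> A i \<subseteq> V \<and> inner_content V \<le> outer (A i) + e * (1/2) ^ Suc i" for i
        unfolding outer_def INF_less_iff by (force intro: less_imp_le)
      then obtain V where V: "\<And>i. openin X (V i)" "\<And>i. A i \<subseteq> V i"
          "\<And>i. inner_content (V i) \<le> outer (A i) + e * (1/2) ^ Suc i"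
        by metis
      have "outer (\<Union>i. A i) \<le> inner_content (\<Union>i. V i)"
        using V by (intro outer_le openin_Union) auto
      also have "\<dots> \<le> (\<Sum>i. inner_content (V i))" using V by (intro inner_UN)
      also have "\<dots> \<le> (\<Sum>i. outer (A i) + e * (1/2) ^ Suc i)"
        using V by (intro suminf_le) auto
      also have "\<dots> = (\<Sum>i. outer (A i)) + (\<Sum>i. ennreal e * ennreal ((1/2) ^ Suc i))"
        using e by (subst suminf_add[symmetric])
          (auto simp del: ennreal_suminf_cmult simp add: ennreal_mult[symmetric])
      also have "\<dots> = (\<Sum>i. outer (A i)) + e"
        unfolding ennreal_suminf_cmult
        by (subst suminf_ennreal_eq[OF zero_le_power power_half_series]) auto
      finally show "outer (\<Union>i. A i) \<le> (\<Sum>i. outer (A i)) + e" .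
    qed
  qed
qed

text \<open>Open sets satisfy the Caratheodory condition because \<open>m\<close> adds up on disjoint closed sets: for
  open \<open>V\<close> containing the test set, exhaust \<open>V \<inter> U\<close> by a closed \<open>K\<close>, and then the open set \<open>V - K\<close>,
  which contains \<open>V - U\<close>, by a closed \<open>L\<close>.\<close>
lemma open_caratheodory:
  assumes U: "openin X U"
  shows "U \<in> lambda_system (topspace X) (Pow (topspace X)) outer"
  unfolding lambda_system_def
proof (intro CollectI conjI ballI)
  show "U \<in> Pow (topspace X)" using openin_subset[OF U] by simp
  fix E assume E: "E \<in> Pow (topspace X)"
  have sub: "subadditive (Pow (topspace X)) outer"
    using outer_measure_space unfolding outer_measure_space_def
    by (metis ring_of_sets.countably_subadditive_subadditive sigma_algebra_Pow
        sigma_algebra.axioms(1) algebra.axioms(1))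
  show "outer (U \<inter> E) + outer ((topspace X - U) \<inter> E) = outer E"
  proof (rule antisym)
    have "E = (U \<inter> E) \<union> ((topspace X - U) \<inter> E)" using E by auto
    then show "outer E \<le> outer (U \<inter> E) + outer ((topspace X - U) \<inter> E)"
      using subadditiveD[OF sub, of "U \<inter> E" "(topspace X - U) \<inter> E"] E by auto
  next
    show "outer (U \<inter> E) + outer ((topspace X - U) \<inter> E) \<le> outer E"
    proof (rule outer_geI)
      fix V assume V: "openin X V" "E \<subseteq> V"
      define r where "r = outer ((topspace X - U) \<inter> E)"
      have key: "ennreal (m K) + r \<le> inner_content V" if K: "closedin X K" "K \<subseteq> V \<inter> U" for K
      proof -
        have "r \<le> inner_content (V - K)"
          unfolding r_def using V K by (intro outer_le openin_diff) auto
        then have "ennreal (m K) + r \<le> ennreal (m K) + inner_content (V - K)" by (rule add_left_mono)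
        also have "\<dots> = (SUP L\<in>{L. closedin X L \<and> L \<subseteq> V - K}. ennreal (m K) + ennreal (m L))"
          unfolding inner_content_def by (rule ennreal_SUP_add_right) (auto intro: exI[of _ "{}"])
        also have "\<dots> \<le> inner_content V"
        proof (rule SUP_least)
          fix L assume L: "L \<in> {L. closedin X L \<and> L \<subseteq> V - K}"
          then have "ennreal (m K) + ennreal (m L) = ennreal (m (K \<union> L))"
            using K closedin_subset[of X K] closedin_subset[of X L]
            by (subst add) (auto simp: nonneg)
          also have "\<dots> \<le> inner_content V" using K L by (intro closed_le_inner) auto
          finally show "ennreal (m K) + ennreal (m L) \<le> inner_content V" .
        qed
        finally show ?thesis .
      qed
      have "outer (U \<inter> E) + r \<le> inner_content (V \<inter> U) + r"
        using U V by (intro add_right_mono outer_le) auto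
      also have "\<dots> = (SUP K\<in>{K. closedin X K \<and> K \<subseteq> V \<inter> U}. ennreal (m K) + r)"
        unfolding inner_content_def by (rule ennreal_SUP_add_left[symmetric]) (auto intro: exI[of _ "{}"])
      also have "\<dots> \<le> inner_content V" using key by (intro SUP_least) auto
      finally show "outer (U \<inter> E) + outer ((topspace X - U) \<inter> E) \<le> inner_content V"
        by (simp add: r_def)
    qed
  qed
qed

lemma sets_regular_measure: "sets regular_measure = sets (borel_of X)"
  and space_regular_measure: "space regular_measure = topspace X"
proof -
  have "{U. openin X U} \<subseteq> Pow (topspace X)" using openin_subset by auto
  then show "sets regular_measure = sets (borel_of X)" "space regular_measure = topspace X"
    by (simp_all add: regular_measure_def borel_of_def)
qed

lemma emeasure_regular_measure:
  assumes "B \<in> sets regular_measure"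
  shows "emeasure regular_measure B = outer B"
proof -
  have sub: "{U. openin X U} \<subseteq> Pow (topspace X)" using openin_subset by auto
  have ms: "measure_space (topspace X) (lambda_system (topspace X) (Pow (topspace X)) outer) outer"
    by (rule sigma_algebra.caratheodory_lemma[OF sigma_algebra_Pow outer_measure_space])
  then have "sigma_sets (topspace X) {U. openin X U} \<subseteq>
      lambda_system (topspace X) (Pow (topspace X)) outer"
    by (intro sigma_algebra.sigma_sets_subset) (auto simp: measure_space_def open_caratheodory)
  from measure_down[OF ms sigma_algebra_sigma_sets[OF sub] this]
  have "measure_space (topspace X) (sigma_sets (topspace X) {U. openin X U}) outer" .
  moreover have "sets regular_measure = sigma_sets (topspace X) {U. openin X U}"
    using sub by (simp add: regular_measure_def)
  ultimately show ?thesis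
    using assms sub by (intro emeasure_measure_of[OF regular_measure_def])
      (auto simp: measure_space_def)
qed

lemma open_sets: "openin X U \<Longrightarrow> U \<in> sets regular_measure"
  using openin_subset[of X] by (auto simp: regular_measure_def)

lemma prob_space_regular_measure: "prob_space regular_measure"
proof
  have "emeasure regular_measure (topspace X) = inner_content (topspace X)"
    by (simp add: emeasure_regular_measure open_sets outer_open)
  also have "\<dots> = 1"
    using inner_le[of "topspace X"] closed_le_inner[of "topspace X" "topspace X"] total
    by (auto intro: antisym)
  finally show "emeasure regular_measure (space regular_measure) = 1"
    by (simp add: space_regular_measure)
qed

sublocale reg: prob_space regular_measure
  by (rule prob_space_regular_measure)

lemma measure_open_le: "openin X V \<Longrightarrow> measure regular_measure V \<le> m V"
  using inner_le[of V] nonneg[of V] openin_subset[of X V]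
  by (simp add: emeasure_regular_measure open_sets outer_open
      flip: reg.emeasure_eq_measure ennreal_le_iff)

lemma outer_regular:
  assumes "B \<in> sets regular_measure" "e > 0"
  shows "\<exists>V. openin X V \<and> B \<subseteq> V \<and> measure regular_measure V \<le> measure regular_measure B + e"
proof -
  have "outer B < emeasure regular_measure B + e"
    using assms
    by (simp add: reg.emeasure_eq_measure ennreal_less_iff flip: emeasure_regular_measure ennreal_plus)
  then obtain V where V: "openin X V" "B \<subseteq> V" "inner_content V < emeasure regular_measure B + e"
    unfolding outer_def INF_less_iff by auto
  then have "emeasure regular_measure V < emeasure regular_measure B + e"
    by (simp add: emeasure_regular_measure open_sets outer_open)
  then have "measure regular_measure V < measure regular_measure B + e"
    using assms(2) by (simp add: reg.emeasure_eq_measure ennreal_less_iff flip: ennreal_plus)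
  then show ?thesis using V by (auto intro: less_imp_le)
qed

text \<open>The link from the Borel measure back to \<open>m\<close>: a Borel set of large measure contains a closed set
  all of whose open neighbourhoods are large for \<open>m\<close>.\<close>
lemma closed_inside:
  assumes B: "B \<in> sets regular_measure" and e: "e > 0"
  shows "\<exists>C. closedin X C \<and> C \<subseteq> B \<and> (\<forall>V. openin X V \<and> C \<subseteq> V \<longrightarrow> m V \<ge> measure regular_measure B - e)"
proof -
  let ?\<mu> = regular_measure
  obtain W where W: "openin X W" "topspace X - B \<subseteq> W" "measure ?\<mu> W \<le> measure ?\<mu> (topspace X - B) + e"
    using outer_regular[of "topspace X - B"] B e
    by (metis sets.compl_sets space_regular_measure)
  have cl: "closedin X (topspace X - W)" using W by auto
  have "measure ?\<mu> (topspace X - W) \<ge> measure ?\<mu> B - e"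
    using W(3) reg.prob_compl[OF B] reg.prob_compl[OF open_sets[OF W(1)]]
    by (simp add: space_regular_measure)
  moreover have "measure ?\<mu> (topspace X - W) \<le> m V" if "openin X V" "topspace X - W \<subseteq> V" for V
    using reg.finite_measure_mono[OF that(2) open_sets[OF that(1)]] measure_open_le[OF that(1)]
    by simp
  moreover have "topspace X - W \<subseteq> B" using W(2) by auto
  ultimately show ?thesis using cl by (intro exI[of _ "topspace X - W"]) force
qed

text \<open>Homeomorphisms permute the closed sets and the open sets, so invariance of \<open>m\<close> passes to both
  steps of the construction.\<close>
lemma outer_preimage_le:
  assumes h: "homeomorphic_map X X h"
    and m: "\<And>B. B \<subseteq> topspace X \<Longrightarrow> m {x \<in> topspace X. h x \<in> B} = m B"
    and E: "E \<subseteq> topspace X"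
  shows "outer {x \<in> topspace X. h x \<in> E} \<le> outer E"
proof (rule outer_geI)
  fix V assume V: "openin X V" "E \<subseteq> V"
  have cont: "continuous_map X X h" using h by (rule homeomorphic_imp_continuous_map)
  have surj: "h ` topspace X = topspace X" using h by (rule homeomorphic_imp_surjective_map)
  have "outer {x \<in> topspace X. h x \<in> E} \<le> inner_content {x \<in> topspace X. h x \<in> V}"
    using V openin_continuous_map_preimage[OF cont V(1)] by (intro outer_le) auto
  also have "\<dots> \<le> inner_content V"
  proof (rule inner_leI)
    fix K assume K: "closedin X K" "K \<subseteq> {x \<in> topspace X. h x \<in> V}"
    have cl: "closedin X (h ` K)" using homeomorphic_imp_closed_map[OF h] K(1)
      by (simp add: closed_map_def)
    have "K \<subseteq> {x \<in> topspace X. h x \<in> h ` K}" using K by auto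
    then have "m K \<le> m {x \<in> topspace X. h x \<in> h ` K}" by (intro mono) auto
    also have "\<dots> = m (h ` K)" using closedin_subset[OF cl] by (rule m)
    finally have "ennreal (m K) \<le> ennreal (m (h ` K))" by (rule ennreal_leI)
    also have "\<dots> \<le> inner_content V" using cl K by (intro closed_le_inner) auto
    finally show "ennreal (m K) \<le> inner_content V" .
  qed
  finally show "outer {x \<in> topspace X. h x \<in> E} \<le> inner_content V" .
qed

lemma invariant_regular_measure:
  assumes "group G" and \<alpha>: "homeo_action G X \<alpha>"
    and inv: "\<And>g B. g \<in> carrier G \<Longrightarrow> B \<subseteq> topspace X \<Longrightarrow> m {x \<in> topspace X. \<alpha> g x \<in> B} = m B"
  shows "invariant_borel_prob G X \<alpha> regular_measure"
proof -
  interpret group G by fact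
  interpret A: group_action G "topspace X" \<alpha> using \<alpha> by (simp add: homeo_action_def)
  have le: "outer {x \<in> topspace X. \<alpha> g x \<in> E} \<le> outer E"
    if "g \<in> carrier G" "E \<subseteq> topspace X" for g E
    using that \<alpha> inv by (intro outer_preimage_le) (auto simp: homeo_action_def)
  have "measure regular_measure {x \<in> topspace X. \<alpha> g x \<in> B} = measure regular_measure B"
    if g: "g \<in> carrier G" and B: "B \<in> sets regular_measure" for g B
  proof -
    have sub: "B \<subseteq> topspace X" using sets.sets_into_space[OF B] by (simp add: space_regular_measure)
    have eq: "{x \<in> topspace X. \<alpha> (inv\<^bsub>G\<^esub> g) x \<in> {x \<in> topspace X. \<alpha> g x \<in> B}} = B"
    proof -
      have "\<alpha> g (\<alpha> (inv\<^bsub>G\<^esub> g) x) = x" "\<alpha> (inv\<^bsub>G\<^esub> g) x \<in> topspace X" if "x \<in> topspace X" for x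
        using that g A.composition_rule[of x g "inv\<^bsub>G\<^esub> g"] A.id_eq_one A.element_image[of "inv\<^bsub>G\<^esub> g" x]
        by (auto simp: restrict_def dest!: fun_cong[where x = x] split: if_splits)
      then show ?thesis using sub by auto
    qed
    have "outer B \<le> outer {x \<in> topspace X. \<alpha> g x \<in> B}"
      using le[of "inv\<^bsub>G\<^esub> g" "{x \<in> topspace X. \<alpha> g x \<in> B}"] g unfolding eq by auto
    with le[OF g sub] have "outer {x \<in> topspace X. \<alpha> g x \<in> B} = outer B" by (rule antisym)
    moreover have "{x \<in> topspace X. \<alpha> g x \<in> B} \<in> sets regular_measure"
    proof -
      have "\<alpha> g \<in> regular_measure \<rightarrow>\<^sub>M regular_measure"
        unfolding regular_measure_def
      proof (rule measurable_measure_of)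
        show "\<alpha> g \<in> space (measure_of (topspace X) {U. openin X U} outer) \<rightarrow> topspace X"
          using A.element_image[OF g] 
          unfolding regular_measure_def[symmetric] by (auto simp: space_regular_measure)
        fix U assume "U \<in> {U. openin X U}"
        moreover have "continuous_map X X (\<alpha> g)"
          using \<alpha> g by (auto simp: homeo_action_def intro: homeomorphic_imp_continuous_map)
        ultimately have "openin X {x \<in> topspace X. \<alpha> g x \<in> U}"
          by (auto intro: openin_continuous_map_preimage)
        then have "{x \<in> topspace X. \<alpha> g x \<in> U} \<in> sets regular_measure" by (rule open_sets)
        then show "\<alpha> g -` U \<inter> space (measure_of (topspace X) {U. openin X U} outer) \<in>
            sets (measure_of (topspace X) {U. openin X U} outer)"
          unfolding regular_measure_def[symmetric]
          by (simp add: space_regular_measure vimage_def Int_def conj_commute)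
      qed (auto dest: openin_subset)
      from measurable_sets[OF this B] show ?thesis
        by (simp add: space_regular_measure vimage_def Int_def conj_commute)
    qed
    ultimately show ?thesis
      using B by (simp add: measure_def emeasure_regular_measure)
  qed
  then show ?thesis
    by (auto simp: invariant_borel_prob_def sets_regular_measure prob_space_regular_measure)
qed

end

section \<open>Limits along invariant sets\<close>

lemma inv_params_nonempty: "({}, 1) \<in> inv_params G"
  by (simp add: inv_params_def)

lemma eventually_inv_net:
  "eventually P (inv_net G) \<longleftrightarrow>
     (\<exists>K \<delta>. (K, \<delta>) \<in> inv_params G \<and>
        (\<forall>K' \<delta>'. (K', \<delta>') \<in> inv_params G \<and> K \<subseteq> K' \<and> \<delta>' \<le> \<delta> \<longrightarrow> P (K', \<delta>')))"
proof -
  have "eventually P (inv_net G) \<longleftrightarrow> (\<exists>p\<in>inv_params G. eventually P (case p of (K, \<delta>) \<Rightarrow>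
      principal {(K', \<delta>'). (K', \<delta>') \<in> inv_params G \<and> K \<subseteq> K' \<and> \<delta>' \<le> \<delta>}))"
    unfolding inv_net_def
  proof (rule eventually_INF_base)
    show "inv_params G \<noteq> {}" using inv_params_nonempty[of G] by blast
  next
    fix a b assume "a \<in> inv_params G" "b \<in> inv_params G"
    moreover obtain K \<delta> L \<epsilon> where "a = (K, \<delta>)" "b = (L, \<epsilon>)" by (metis surj_pair)
    ultimately show "\<exists>x\<in>inv_params G.
        (case x of (K, \<delta>) \<Rightarrow> principal {(K', \<delta>'). (K', \<delta>') \<in> inv_params G \<and> K \<subseteq> K' \<and> \<delta>' \<le> \<delta>})
        \<le> inf (case a of (K, \<delta>) \<Rightarrow> principal {(K', \<delta>'). (K', \<delta>') \<in> inv_params G \<and> K \<subseteq> K' \<and> \<delta>' \<le> \<delta>})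
              (case b of (K, \<delta>) \<Rightarrow> principal {(K', \<delta>'). (K', \<delta>') \<in> inv_params G \<and> K \<subseteq> K' \<and> \<delta>' \<le> \<delta>})"
      by (intro bexI[of _ "(K \<union> L, min \<delta> \<epsilon>)"]) (auto simp: inv_params_def)
  qed
  then show ?thesis by (simp add: Bex_def Ball_def eventually_principal)
qed

lemma inv_net_neq_bot: "inv_net G \<noteq> bot"
proof
  assume "inv_net G = bot"
  then have "eventually (\<lambda>_. False) (inv_net G)" by simp
  then obtain K \<delta> where "(K, \<delta>) \<in> inv_params G"
      "\<And>K' \<delta>'. (K', \<delta>') \<in> inv_params G \<and> K \<subseteq> K' \<and> \<delta>' \<le> \<delta> \<Longrightarrow> False"
    unfolding eventually_inv_net by auto
  from this(2)[of K \<delta>] this(1) show False by simp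
qed

lemma eventually_in_inv_params: "eventually (\<lambda>p. p \<in> inv_params G) (inv_net G)"
  unfolding eventually_inv_net using inv_params_nonempty[of G]
  by (intro exI[of _ "{}"] exI[of _ 1]) simp

lemma tendsto_inv_net_INF:
  fixes f :: "'g set \<times> real \<Rightarrow> ereal"
  assumes anti: "\<And>K \<delta> K' \<delta>'. (K, \<delta>) \<in> inv_params G \<Longrightarrow> (K', \<delta>') \<in> inv_params G \<Longrightarrow> K \<subseteq> K' \<Longrightarrow>
      \<delta>' \<le> \<delta> \<Longrightarrow> f (K', \<delta>') \<le> f (K, \<delta>)"
  shows "(f \<longlongrightarrow> (INF p\<in>inv_params G. f p)) (inv_net G)"
proof (rule order_tendstoI)
  fix a assume "a < (INF p\<in>inv_params G. f p)"
  then have "a < f p" if "p \<in> inv_params G" for p using INF_lower[OF that, of f] by order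
  then show "eventually (\<lambda>p. a < f p) (inv_net G)"
    using eventually_in_inv_params by (rule eventually_mono[rotated])
next
  fix a assume "(INF p\<in>inv_params G. f p) < a"
  then obtain K \<delta> where "(K, \<delta>) \<in> inv_params G" "f (K, \<delta>) < a" unfolding INF_less_iff by auto
  then show "eventually (\<lambda>p. f p < a) (inv_net G)"
    unfolding eventually_inv_net using anti by (meson order.strict_trans1)
qed

lemma tendsto_inv_net_SUP:
  fixes f :: "'g set \<times> real \<Rightarrow> ereal"
  assumes mono: "\<And>K \<delta> K' \<delta>'. (K, \<delta>) \<in> inv_params G \<Longrightarrow> (K', \<delta>') \<in> inv_params G \<Longrightarrow> K \<subseteq> K' \<Longrightarrow>
      \<delta>' \<le> \<delta> \<Longrightarrow> f (K, \<delta>) \<le> f (K', \<delta>')"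
  shows "(f \<longlongrightarrow> (SUP p\<in>inv_params G. f p)) (inv_net G)"
proof (rule order_tendstoI)
  fix a assume "(SUP p\<in>inv_params G. f p) < a"
  then have "f p < a" if "p \<in> inv_params G" for p using SUP_upper[OF that, of f] by order
  then show "eventually (\<lambda>p. f p < a) (inv_net G)"
    using eventually_in_inv_params by (rule eventually_mono[rotated])
next
  fix a assume "a < (SUP p\<in>inv_params G. f p)"
  then obtain K \<delta> where "(K, \<delta>) \<in> inv_params G" "a < f (K, \<delta>)" unfolding less_SUP_iff by auto
  then show "eventually (\<lambda>p. a < f p) (inv_net G)"
    unfolding eventually_inv_net using mono by (meson order.strict_trans2)
qed

lemma inv_sets_anti_mono:
  assumes "K \<subseteq> K'" "\<delta>' \<le> \<delta>"
  shows "inv_sets G K' \<delta>' \<subseteq> inv_sets G K \<delta>"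
proof
  fix F assume F: "F \<in> inv_sets G K' \<delta>'"
  then have fin: "finite F" by (simp add: inv_sets_def)
  have "{s \<in> F. K' #>\<^bsub>G\<^esub> s \<subseteq> F} \<subseteq> {s \<in> F. K #>\<^bsub>G\<^esub> s \<subseteq> F}"
    using assms(1) by (auto simp: r_coset_def)
  then have "card {s \<in> F. K' #>\<^bsub>G\<^esub> s \<subseteq> F} \<le> card {s \<in> F. K #>\<^bsub>G\<^esub> s \<subseteq> F}"
    using fin by (intro card_mono) auto
  moreover have "(1 - \<delta>) * real (card F) \<le> (1 - \<delta>') * real (card F)"
    using assms(2) by (intro mult_right_mono) auto
  ultimately show "F \<in> inv_sets G K \<delta>" using F by (auto simp: inv_sets_def)
qed

text \<open>Shrinking the family of admissible sets lowers the supremum, so the net is monotone and its limit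
  is an infimum.\<close>
lemma inv_limsup_eq_INF:
  "inv_limsup G \<phi> =
     (INF p\<in>inv_params G. SUP F\<in>inv_sets G (fst p) (snd p). ereal (\<phi> F / real (card F)))"
proof -
  have "((\<lambda>p. SUP F\<in>inv_sets G (fst p) (snd p). ereal (\<phi> F / real (card F))) \<longlongrightarrow>
      (INF p\<in>inv_params G. SUP F\<in>inv_sets G (fst p) (snd p). ereal (\<phi> F / real (card F)))) (inv_net G)"
    by (rule tendsto_inv_net_INF, simp, rule SUP_subset_mono[OF inv_sets_anti_mono]) auto
  then show ?thesis
    unfolding inv_limsup_def case_prod_beta by (rule tendsto_Lim[OF inv_net_neq_bot])
qed

lemma inv_liminf_eq_SUP:
  "inv_liminf G \<phi> =
     (SUP p\<in>inv_params G. INF F\<in>inv_sets G (fst p) (snd p). ereal (\<phi> F / real (card F)))"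
proof -
  have "((\<lambda>p. INF F\<in>inv_sets G (fst p) (snd p). ereal (\<phi> F / real (card F))) \<longlongrightarrow>
      (SUP p\<in>inv_params G. INF F\<in>inv_sets G (fst p) (snd p). ereal (\<phi> F / real (card F)))) (inv_net G)"
    by (rule tendsto_inv_net_SUP, simp, rule INF_superset_mono[OF inv_sets_anti_mono]) auto
  then show ?thesis
    unfolding inv_liminf_def case_prod_beta by (rule tendsto_Lim[OF inv_net_neq_bot])
qed

text \<open>By Folner's theorem every amenable group has this property. If it failed, suprema over an empty
  set would enter every limit, and there would be no tuple of either kind, so the two cases are
  treated separately.\<close>
definition folner :: "('g, 'b) monoid_scheme \<Rightarrow> bool" where
  "folner G \<longleftrightarrow> (\<forall>(K, \<delta>)\<in>inv_params G. inv_sets G K \<delta> \<noteq> {})"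

lemma folnerD: "folner G \<Longrightarrow> p \<in> inv_params G \<Longrightarrow> inv_sets G (fst p) (snd p) \<noteq> {}"
  by (auto simp: folner_def split: prod.splits)

lemma inv_limsup_not_folner:
  assumes "\<not> folner G"
  shows "inv_limsup G \<phi> = -\<infinity>"
proof -
  obtain K \<delta> where "(K, \<delta>) \<in> inv_params G" "inv_sets G K \<delta> = {}"
    using assms by (auto simp: folner_def)
  then have "inv_limsup G \<phi> \<le> bot"
    unfolding inv_limsup_eq_INF by (intro INF_lower2[of "(K, \<delta>)"]) auto
  then show ?thesis by (simp add: bot_ereal_def)
qed

lemma inv_limsup_ge:
  assumes "folner G" and "\<And>F. finite F \<Longrightarrow> F \<noteq> {} \<Longrightarrow> F \<subseteq> carrier G \<Longrightarrow> c * real (card F) \<le> \<phi> F"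
  shows "ereal c \<le> inv_limsup G \<phi>"
  unfolding inv_limsup_eq_INF
proof (rule INF_greatest)
  fix p assume "p \<in> inv_params G"
  then obtain F where F: "F \<in> inv_sets G (fst p) (snd p)" using folnerD[OF assms(1)] by blast
  then have "card F > 0" by (auto simp: inv_sets_def card_gt_0_iff)
  then have "c \<le> \<phi> F / real (card F)"
    using assms(2)[of F] F by (simp add: pos_le_divide_eq inv_sets_def)
  then show "ereal c \<le> (SUP F\<in>inv_sets G (fst p) (snd p). ereal (\<phi> F / real (card F)))"
    using F by (intro SUP_upper2[OF F]) simp
qed

lemma inv_limsup_mono:
  assumes "\<And>F. finite F \<Longrightarrow> \<phi> F \<le> \<psi> F"
  shows "inv_limsup G \<phi> \<le> inv_limsup G \<psi>"
  unfolding inv_limsup_eq_INF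
proof (rule INF_mono)
  fix p :: "'a set \<times> real" assume p: "p \<in> inv_params G"
  have "(SUP F\<in>inv_sets G (fst p) (snd p). ereal (\<phi> F / real (card F)))
      \<le> (SUP F\<in>inv_sets G (fst p) (snd p). ereal (\<psi> F / real (card F)))"
    using assms by (intro SUP_mono) (auto simp: inv_sets_def intro!: divide_right_mono)
  then show "\<exists>q\<in>inv_params G. (SUP F\<in>inv_sets G (fst q) (snd q). ereal (\<phi> F / real (card F)))
      \<le> (SUP F\<in>inv_sets G (fst p) (snd p). ereal (\<psi> F / real (card F)))"
    using p by blast
qed

lemma has_inv_limitI:
  assumes fol: "folner G"
    and lower: "\<And>F. finite F \<Longrightarrow> F \<noteq> {} \<Longrightarrow> F \<subseteq> carrier G \<Longrightarrow> L \<le> \<phi> F / real (card F)"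
    and upper: "\<And>a. L < a \<Longrightarrow> \<exists>K \<delta>. (K, \<delta>) \<in> inv_params G \<and>
      (\<forall>F\<in>inv_sets G K \<delta>. \<phi> F / real (card F) \<le> a)"
  shows "has_inv_limit G \<phi> (ereal L)"
proof -
  have sup: "inv_limsup G \<phi> \<le> ereal L"
  proof (rule ereal_le_epsilon2)
    fix e :: real assume "0 < e"
    then obtain K \<delta> where p: "(K, \<delta>) \<in> inv_params G" "\<forall>F\<in>inv_sets G K \<delta>. \<phi> F / real (card F) \<le> L + e"
      using upper[of "L + e"] by auto
    show "inv_limsup G \<phi> \<le> ereal L + ereal e"
      unfolding inv_limsup_eq_INF using p by (intro INF_lower2[OF p(1)] SUP_least) auto
  qed
  have inf: "ereal L \<le> inv_liminf G \<phi>"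
    unfolding inv_liminf_eq_SUP
    by (rule SUP_upper2[OF inv_params_nonempty], rule INF_greatest) (simp add: lower inv_sets_def)
  have "inv_liminf G \<phi> \<le> inv_limsup G \<phi>"
  proof -
    have "((\<lambda>p. INF F\<in>inv_sets G (fst p) (snd p). ereal (\<phi> F / real (card F))) \<longlongrightarrow> inv_liminf G \<phi>) (inv_net G)"
      unfolding inv_liminf_eq_SUP
      by (rule tendsto_inv_net_SUP, simp, rule INF_superset_mono[OF inv_sets_anti_mono]) auto
    moreover have "((\<lambda>p. SUP F\<in>inv_sets G (fst p) (snd p). ereal (\<phi> F / real (card F))) \<longlongrightarrow> inv_limsup G \<phi>) (inv_net G)"
      unfolding inv_limsup_eq_INF
      by (rule tendsto_inv_net_INF, simp, rule SUP_subset_mono[OF inv_sets_anti_mono]) auto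
    moreover have "eventually (\<lambda>p. (INF F\<in>inv_sets G (fst p) (snd p). ereal (\<phi> F / real (card F)))
        \<le> (SUP F\<in>inv_sets G (fst p) (snd p). ereal (\<phi> F / real (card F)))) (inv_net G)"
      using eventually_in_inv_params
    proof (rule eventually_mono)
      fix p assume "p \<in> inv_params G"
      then have "inv_sets G (fst p) (snd p) \<noteq> {}" using folnerD[OF fol] by blast
      then show "(INF F\<in>inv_sets G (fst p) (snd p). ereal (\<phi> F / real (card F)))
        \<le> (SUP F\<in>inv_sets G (fst p) (snd p). ereal (\<phi> F / real (card F)))"
        by (rule INF_le_SUP)
    qed
    ultimately show ?thesis by (intro tendsto_le[OF inv_net_neq_bot])
  qed
  with sup inf show ?thesis unfolding has_inv_limit_def by (meson order_antisym order_trans)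
qed

section \<open>Independence density\<close>

locale homeo_system = group G for G :: "('g, 'b) monoid_scheme" (structure) +
  fixes X :: "'x topology" and \<alpha> :: "'g \<Rightarrow> 'x \<Rightarrow> 'x"
  assumes homeo_action: "homeo_action G X \<alpha>" and nonempty: "topspace X \<noteq> {}"
begin

lemma act_closed: "g \<in> carrier G \<Longrightarrow> x \<in> topspace X \<Longrightarrow> \<alpha> g x \<in> topspace X"
  using homeo_action group_action.element_image unfolding homeo_action_def by metis

lemma act_mult:
  "g \<in> carrier G \<Longrightarrow> h \<in> carrier G \<Longrightarrow> x \<in> topspace X \<Longrightarrow> \<alpha> g (\<alpha> h x) = \<alpha> (g \<otimes> h) x"
  using homeo_action group_action.composition_rule unfolding homeo_action_def by metis

lemma indep_empty: "indep_set G X \<alpha> k A D {}"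
  by (simp add: indep_set_def)

lemma indep_subset: "indep_set G X \<alpha> k A D J \<Longrightarrow> J' \<subseteq> J \<Longrightarrow> indep_set G X \<alpha> k A D J'"
  unfolding indep_set_def by (meson order_trans)

lemma indep_mono:
  assumes "indep_set G X \<alpha> k A D J" "\<And>i. i \<in> {1..k} \<Longrightarrow> A i \<subseteq> B i" "D \<subseteq> E"
  shows "indep_set G X \<alpha> k B E J"
  unfolding indep_set_def
proof (intro conjI allI impI)
  show "J \<subseteq> carrier G" using assms(1) by (simp add: indep_set_def)
  fix F \<sigma> assume F: "finite F \<and> F \<noteq> {} \<and> F \<subseteq> J \<and> \<sigma> \<in> F \<rightarrow> {1..k}"
  then have "D \<inter> (\<Inter>s\<in>F. {x \<in> topspace X. \<alpha> s x \<in> A (\<sigma> s)}) \<noteq> {}"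
    using assms(1) unfolding indep_set_def by blast
  moreover have "D \<inter> (\<Inter>s\<in>F. {x \<in> topspace X. \<alpha> s x \<in> A (\<sigma> s)})
      \<subseteq> E \<inter> (\<Inter>s\<in>F. {x \<in> topspace X. \<alpha> s x \<in> B (\<sigma> s)})"
  proof (intro Int_mono assms(3) INF_mono)
    fix s assume s: "s \<in> F"
    then have "A (\<sigma> s) \<subseteq> B (\<sigma> s)" using F by (intro assms(2)) auto
    then show "\<exists>t\<in>F. {x \<in> topspace X. \<alpha> t x \<in> A (\<sigma> t)} \<subseteq> {x \<in> topspace X. \<alpha> s x \<in> B (\<sigma> s)}"
      using s by blast
  qed
  ultimately show "E \<inter> (\<Inter>s\<in>F. {x \<in> topspace X. \<alpha> s x \<in> B (\<sigma> s)}) \<noteq> {}" by blast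
qed

lemma indep_cards_finite:
  assumes "finite F"
  shows "finite {card (F \<inter> J) |J. indep_set G X \<alpha> k A D J}"
  by (rule finite_subset[of _ "{..card F}"]) (auto intro!: card_mono assms)

lemma max_indep_ge:
  assumes "finite F" "indep_set G X \<alpha> k A D J"
  shows "card (F \<inter> J) \<le> max_indep G X \<alpha> k A D F"
  unfolding max_indep_def using assms by (intro Max_ge indep_cards_finite) auto

lemma max_indep_attained:
  assumes "finite F"
  obtains J where "J \<subseteq> F" "indep_set G X \<alpha> k A D J" "card J = max_indep G X \<alpha> k A D F"
proof -
  have "max_indep G X \<alpha> k A D F \<in> {card (F \<inter> J) |J. indep_set G X \<alpha> k A D J}"
    unfolding max_indep_def using indep_empty
    by (intro Max_in indep_cards_finite assms) auto
  then obtain J where "indep_set G X \<alpha> k A D J" "card (F \<inter> J) = max_indep G X \<alpha> k A D F" by auto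
  then show ?thesis using that[of "F \<inter> J"] indep_subset by auto
qed

lemma max_indep_le_card: "finite F \<Longrightarrow> max_indep G X \<alpha> k A D F \<le> card F"
  by (metis card_mono max_indep_attained)

text \<open>If \<open>x\<close> realizes a pattern at the points \<open>t \<otimes> g\<close>, then \<open>\<alpha> g x\<close> realizes it at the points \<open>t\<close>.\<close>
lemma indep_translate:
  assumes J: "indep_set G X \<alpha> k A (topspace X) J" and g: "g \<in> carrier G"
  shows "indep_set G X \<alpha> k A (topspace X) {t \<in> carrier G. t \<otimes> g \<in> J}"
  unfolding indep_set_def
proof (intro conjI allI impI)
  fix F \<sigma> assume F: "finite F \<and> F \<noteq> {} \<and> F \<subseteq> {t \<in> carrier G. t \<otimes> g \<in> J} \<and> \<sigma> \<in> F \<rightarrow> {1..k}"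
  define F' where "F' = (\<lambda>t. t \<otimes> g) ` F"
  define \<sigma>' where "\<sigma>' s = \<sigma> (s \<otimes> inv g)" for s
  have cancel: "t \<otimes> g \<otimes> inv g = t" if "t \<in> F" for t
    using that F g by (auto simp: m_assoc)
  have "topspace X \<inter> (\<Inter>s\<in>F'. {x \<in> topspace X. \<alpha> s x \<in> A (\<sigma>' s)}) \<noteq> {}"
  proof -
    have "finite F' \<and> F' \<noteq> {} \<and> F' \<subseteq> J \<and> \<sigma>' \<in> F' \<rightarrow> {1..k}"
      using F cancel by (auto simp: F'_def \<sigma>'_def Pi_def)
    then show ?thesis using J unfolding indep_set_def by blast
  qed
  then obtain x where x: "x \<in> topspace X" "\<And>t. t \<in> F \<Longrightarrow> \<alpha> (t \<otimes> g) x \<in> A (\<sigma> t)"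
    using cancel by (auto simp: F'_def \<sigma>'_def)
  have "\<alpha> g x \<in> topspace X \<inter> (\<Inter>s\<in>F. {x \<in> topspace X. \<alpha> s x \<in> A (\<sigma> s)})"
    using x F g by (auto simp: act_closed act_mult)
  then show "topspace X \<inter> (\<Inter>s\<in>F. {x \<in> topspace X. \<alpha> s x \<in> A (\<sigma> s)}) \<noteq> {}" by blast
qed auto

text \<open>A translate of \<open>K\<close> that meets \<open>F\<close> at \<open>f = k \<otimes> s\<close> is determined by \<open>s = inv k \<otimes> f\<close>. This lies in
  \<open>F\<close> unless \<open>f\<close> is one of the at most \<open>\<delta> * card F\<close> points near the boundary.\<close>
lemma card_translates_meeting:
  assumes K: "finite K" "K \<subseteq> carrier G" and F: "F \<in> inv_sets G ((\<lambda>k. inv k) ` K) \<delta>"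
  shows "finite {s \<in> carrier G. \<exists>k\<in>K. k \<otimes> s \<in> F}"
    and "real (card {s \<in> carrier G. \<exists>k\<in>K. k \<otimes> s \<in> F}) \<le> (1 + \<delta> * real (card K)) * real (card F)"
proof -
  define S where "S = {s \<in> carrier G. \<exists>k\<in>K. k \<otimes> s \<in> F}"
  define core where "core = {s \<in> F. (\<lambda>k. inv k) ` K #> s \<subseteq> F}"
  have fin: "finite F" and FG: "F \<subseteq> carrier G" and cg: "real (card core) \<ge> (1 - \<delta>) * real (card F)"
    using F by (auto simp: inv_sets_def core_def)
  have gF: "core \<subseteq> F" by (auto simp: core_def)
  have "S \<subseteq> F \<union> (\<lambda>(k, f). inv k \<otimes> f) ` (K \<times> (F - core))"
  proof
    fix s assume "s \<in> S"
    then obtain k where k: "s \<in> carrier G" "k \<in> K" "k \<otimes> s \<in> F" by (auto simp: S_def)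
    then have s: "s = inv k \<otimes> (k \<otimes> s)" using K(2) by (auto simp: m_assoc[symmetric])
    show "s \<in> F \<union> (\<lambda>(k, f). inv k \<otimes> f) ` (K \<times> (F - core))"
    proof (cases "k \<otimes> s \<in> core")
      case True
      then have "inv k \<otimes> (k \<otimes> s) \<in> F" using k by (auto simp: core_def r_coset_def)
      then show ?thesis using s by simp
    next
      case False
      then have "(k, k \<otimes> s) \<in> K \<times> (F - core)" using k by simp
      then show ?thesis using s by (metis (no_types, lifting) UnI2 case_prod_conv rev_image_eqI)
    qed
  qed
  moreover have fin': "finite (F \<union> (\<lambda>(k, f). inv k \<otimes> f) ` (K \<times> (F - core)))"
    using fin K by auto
  ultimately have finS: "finite S" and "card S \<le> card (F \<union> (\<lambda>(k, f). inv k \<otimes> f) ` (K \<times> (F - core)))"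
    by (auto intro: finite_subset card_mono)
  then have "card S \<le> card F + card ((\<lambda>(k, f). inv k \<otimes> f) ` (K \<times> (F - core)))"
    using card_Un_le[of F] order_trans by blast
  also have "\<dots> \<le> card F + card (K \<times> (F - core))"
    using K fin by (intro add_left_mono card_image_le) auto
  finally have "card S \<le> card F + card K * card (F - core)" by (simp add: card_cartesian_product)
  then have "real (card S) \<le> real (card F) + real (card K) * real (card (F - core))"
    by (metis of_nat_add of_nat_le_iff of_nat_mult)
  also have "real (card (F - core)) \<le> \<delta> * real (card F)"
    using cg card_Diff_subset[of core F] finite_subset[OF gF fin] gF card_mono[OF fin gF]
    by (simp add: of_nat_diff algebra_simps)
  finally have "real (card S) \<le> real (card F) + real (card K) * (\<delta> * real (card F))"
    by (simp add: mult_left_mono)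
  then have "real (card S) \<le> (1 + \<delta> * real (card K)) * real (card F)" by (simp add: algebra_simps)
  with finS show "finite {s \<in> carrier G. \<exists>k\<in>K. k \<otimes> s \<in> F}"
    "real (card {s \<in> carrier G. \<exists>k\<in>K. k \<otimes> s \<in> F}) \<le> (1 + \<delta> * real (card K)) * real (card F)"
    by (simp_all add: S_def)
qed

text \<open>The reason for the existence of the limit. Cover \<open>F\<close> by the right translates
  of \<open>K\<close> that meet it; every point of an independence set \<open>J \<subseteq> F\<close> lies in exactly \<open>card K\<close> of them, and
  each of them contains at most as many points of \<open>J\<close> as an independence set in \<open>K\<close> can have. If \<open>F\<close>
  is sufficiently invariant, there are hardly more than \<open>card F\<close> such translates.\<close>
lemma max_indep_ratio_le:
  assumes K: "finite K" "K \<noteq> {}" "K \<subseteq> carrier G" and F: "F \<in> inv_sets G ((\<lambda>k. inv k) ` K) \<delta>"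
  shows "real (max_indep G X \<alpha> k A (topspace X) F) / real (card F) \<le>
    (1 + \<delta> * real (card K)) * (real (max_indep G X \<alpha> k A (topspace X) K) / real (card K))"
proof -
  let ?\<phi> = "max_indep G X \<alpha> k A (topspace X)"
  define S where "S = {s \<in> carrier G. \<exists>k\<in>K. k \<otimes> s \<in> F}"
  note S = card_translates_meeting[OF K(1,3) F, folded S_def]
  have fin: "finite F" and FG: "F \<subseteq> carrier G" and F0: "F \<noteq> {}"
    using F by (auto simp: inv_sets_def)
  obtain J where J: "J \<subseteq> F" "indep_set G X \<alpha> k A (topspace X) J" "card J = ?\<phi> F"
    using max_indep_attained[OF fin] .
  have "card {s \<in> S. h \<otimes> s \<in> J} = card J" if h: "h \<in> K" for h
  proof (rule bij_betw_same_card[of "\<lambda>s. h \<otimes> s"], rule bij_betwI[where g = "\<lambda>t. inv h \<otimes> t"])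
    have hG: "h \<in> carrier G" using h K by blast
    show "(\<lambda>s. h \<otimes> s) \<in> {s \<in> S. h \<otimes> s \<in> J} \<rightarrow> J" by auto
    have 1: "h \<otimes> (inv h \<otimes> t) = t" if "t \<in> J" for t
      using that hG J(1) FG by (simp add: m_assoc[symmetric] subset_iff)
    then show "(\<lambda>t. inv h \<otimes> t) \<in> J \<rightarrow> {s \<in> S. h \<otimes> s \<in> J}"
      using J(1) FG hG h by (auto simp: S_def subset_iff intro!: bexI[of _ h])
    show "h \<otimes> (inv h \<otimes> t) = t" if "t \<in> J" for t using 1 that .
    show "inv h \<otimes> (h \<otimes> s) = s" if "s \<in> {s \<in> S. h \<otimes> s \<in> J}" for s
      using that hG by (simp add: m_assoc[symmetric] S_def)
  qed
  then have "card K * ?\<phi> F = (\<Sum>h\<in>K. card {s \<in> S. h \<otimes> s \<in> J})"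
    using J(3) by simp
  also have "\<dots> = (\<Sum>s\<in>S. card {h \<in> K. h \<otimes> s \<in> J})"
    using sum.swap_restrict[OF K(1) S(1), of "\<lambda>_ _. 1::nat" "\<lambda>h s. h \<otimes> s \<in> J"] by simp
  also have "\<dots> \<le> (\<Sum>s\<in>S. ?\<phi> K)"
  proof (rule sum_mono)
    fix s assume "s \<in> S"
    then have "s \<in> carrier G" by (simp add: S_def)
    from max_indep_ge[OF K(1) indep_translate[OF J(2) this]]
    have "card (K \<inter> {t \<in> carrier G. t \<otimes> s \<in> J}) \<le> ?\<phi> K" .
    moreover have "K \<inter> {t \<in> carrier G. t \<otimes> s \<in> J} = {h \<in> K. h \<otimes> s \<in> J}" using K by auto
    ultimately show "card {h \<in> K. h \<otimes> s \<in> J} \<le> ?\<phi> K" by simp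
  qed
  finally have "card K * ?\<phi> F \<le> card S * ?\<phi> K" by simp
  then have "real (card K) * real (?\<phi> F) \<le> real (card S) * real (?\<phi> K)"
    by (metis of_nat_le_iff of_nat_mult)
  also have "\<dots> \<le> (1 + \<delta> * real (card K)) * real (card F) * real (?\<phi> K)"
    using S(2) by (rule mult_right_mono) simp
  finally have "real (card K) * real (?\<phi> F) \<le> (1 + \<delta> * real (card K)) * real (card F) * real (?\<phi> K)" .
  moreover have "real (card K) > 0" "real (card F) > 0" using K F0 fin by (auto simp: card_gt_0_iff)
  ultimately show ?thesis by (simp add: field_simps)
qed

text \<open>The infimum over all finite sets turns out to be the limit along invariant sets.\<close>
definition indep_density :: "nat \<Rightarrow> (nat \<Rightarrow> 'x set) \<Rightarrow> real" where
  "indep_density k A = (INF K\<in>{K. finite K \<and> K \<noteq> {} \<and> K \<subseteq> carrier G}.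
     real (max_indep G X \<alpha> k A (topspace X) K) / real (card K))"

lemma indep_density_le:
  assumes "finite K" "K \<noteq> {}" "K \<subseteq> carrier G"
  shows "indep_density k A \<le> real (max_indep G X \<alpha> k A (topspace X) K) / real (card K)"
  unfolding indep_density_def using assms by (intro cINF_lower bdd_belowI2[of _ 0]) auto

lemma max_indep_has_inv_limit:
  assumes "folner G"
  shows "has_inv_limit G (\<lambda>F. real (max_indep G X \<alpha> k A (topspace X) F)) (ereal (indep_density k A))"
proof (rule has_inv_limitI[OF assms])
  fix F assume "finite F" "F \<noteq> {}" "F \<subseteq> carrier G"
  then show "indep_density k A \<le> real (max_indep G X \<alpha> k A (topspace X) F) / real (card F)"
    by (rule indep_density_le)
next
  fix a assume "indep_density k A < a"
  then obtain K where K: "finite K" "K \<noteq> {}" "K \<subseteq> carrier G"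
      "real (max_indep G X \<alpha> k A (topspace X) K) / real (card K) < a"
    unfolding indep_density_def
    by (subst (asm) cINF_less_iff) (auto intro!: bdd_belowI2[of _ 0] exI[of _ "{\<one>}"])
  define r where "r = real (max_indep G X \<alpha> k A (topspace X) K) / real (card K)"
  have c: "real (card K) > 0" using K by (simp add: card_gt_0_iff)
  have r: "0 \<le> r" "r \<le> 1" "r < a"
    using K c max_indep_le_card[OF K(1), of k A "topspace X"] by (auto simp: r_def)
  define \<delta> where "\<delta> = (a - r) / real (card K)"
  have \<delta>: "\<delta> > 0" using r c by (simp add: \<delta>_def)
  show "\<exists>K \<delta>. (K, \<delta>) \<in> inv_params G \<and>
      (\<forall>F\<in>inv_sets G K \<delta>. real (max_indep G X \<alpha> k A (topspace X) F) / real (card F) \<le> a)"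
  proof (intro exI conjI ballI)
    show "((\<lambda>k. inv k) ` K, \<delta>) \<in> inv_params G" using K \<delta> by (auto simp: inv_params_def)
    fix F assume "F \<in> inv_sets G ((\<lambda>k. inv k) ` K) \<delta>"
    from max_indep_ratio_le[OF K(1-3) this]
    have "real (max_indep G X \<alpha> k A (topspace X) F) / real (card F) \<le> (1 + \<delta> * real (card K)) * r"
      by (simp add: r_def)
    also have "\<dots> = r + (a - r) * r" using c by (simp add: \<delta>_def field_simps)
    also have "\<dots> \<le> r + (a - r)" using r by (intro add_left_mono mult_left_le) auto
    finally show "real (max_indep G X \<alpha> k A (topspace X) F) / real (card F) \<le> a" by simp
  qed
qed

end

section \<open>Invariant means that detect independence\<close>

text \<open>Forgetting the colours outside \<open>I\<close> does not lower the proportion of colourings that occur.\<close>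
lemma card_le_card_restrict_image:
  assumes S: "S \<subseteq> J \<rightarrow>\<^sub>E C" and fin: "finite J" "finite C" and I: "I \<subseteq> J"
  shows "card S \<le> card ((\<lambda>\<sigma>. restrict \<sigma> I) ` S) * card C ^ card (J - I)"
proof -
  let ?f = "\<lambda>\<sigma>. (restrict \<sigma> I, restrict \<sigma> (J - I))"
  have finS: "finite S" using S fin by (meson finite_PiE finite_subset)
  have "inj_on ?f S"
  proof (rule inj_onI)
    fix \<sigma> \<tau> assume h: "\<sigma> \<in> S" "\<tau> \<in> S" "?f \<sigma> = ?f \<tau>"
    show "\<sigma> = \<tau>"
    proof
      fix x
      consider "x \<in> I" | "x \<in> J - I" | "x \<notin> J" using I by blast
      then show "\<sigma> x = \<tau> x"
      proof cases
        case 1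
        then show ?thesis using h(3) by (metis prod.inject restrict_apply')
      next
        case 2
        then show ?thesis using h(3) by (metis prod.inject restrict_apply')
      next
        case 3
        then show ?thesis using h(1,2) S by (metis PiE_arb subsetD)
      qed
    qed
  qed
  moreover have "?f ` S \<subseteq> (\<lambda>\<sigma>. restrict \<sigma> I) ` S \<times> ((J - I) \<rightarrow>\<^sub>E C)"
  proof (rule image_subsetI)
    fix \<sigma> assume \<sigma>: "\<sigma> \<in> S"
    then have "restrict \<sigma> (J - I) \<in> (J - I) \<rightarrow>\<^sub>E C" using S by auto
    then show "?f \<sigma> \<in> (\<lambda>\<sigma>. restrict \<sigma> I) ` S \<times> ((J - I) \<rightarrow>\<^sub>E C)" using \<sigma> by simp
  qed
  moreover have "finite ((\<lambda>\<sigma>. restrict \<sigma> I) ` S \<times> ((J - I) \<rightarrow>\<^sub>E C))"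
    using finS fin by (intro finite_cartesian_product finite_imageI finite_PiE) auto
  ultimately have "card S \<le> card ((\<lambda>\<sigma>. restrict \<sigma> I) ` S \<times> ((J - I) \<rightarrow>\<^sub>E C))"
    by (rule card_inj_on_le)
  then show ?thesis using fin by (simp add: card_cartesian_product card_PiE)
qed

text \<open>Tychonoff's theorem for the cube of all functions from \<open>'b\<close> to the unit interval, in the form in
  which it is used: finitely many values of a cluster point are approximated simultaneously, by
  members that satisfy any eventually valid condition.\<close>
lemma cluster_point_unit_interval:
  fixes f :: "'p \<Rightarrow> 'b \<Rightarrow> real"
  assumes "\<F> \<noteq> bot" and f: "\<And>p b. f p b \<in> {0..1}"
  shows "\<exists>m. \<forall>P \<B> e. eventually P \<F> \<and> finite \<B> \<and> e > 0 \<longrightarrow>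
           (\<exists>p. P p \<and> (\<forall>b\<in>\<B>. \<bar>f p b - m b\<bar> < e))"
proof -
  have "compactin (product_topology (\<lambda>_. euclidean) UNIV) (UNIV \<rightarrow>\<^sub>E {0..1::real})"
    by (simp add: compactin_PiE)
  then have "compact (UNIV \<rightarrow>\<^sub>E {0..1} :: ('b \<Rightarrow> real) set)"
    by (simp add: euclidean_product_topology)
  moreover have "eventually (\<lambda>h. h \<in> UNIV \<rightarrow>\<^sub>E {0..1}) (filtermap f \<F>)"
    using f by (simp add: eventually_filtermap PiE_UNIV_domain)
  moreover have "filtermap f \<F> \<noteq> bot" using assms(1) by (simp add: filtermap_bot_iff)
  ultimately obtain m where m: "inf (nhds m) (filtermap f \<F>) \<noteq> bot"
    unfolding compact_filter by blast
  have "\<exists>p. P p \<and> (\<forall>b\<in>\<B>. \<bar>f p b - m b\<bar> < e)"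
    if h: "eventually P \<F>" "finite \<B>" "e > 0" for P \<B> e
  proof (rule ccontr)
    assume no: "\<not> ?thesis"
    define N where "N = (\<Inter>b\<in>\<B>. {h :: 'b \<Rightarrow> real. \<bar>h b - m b\<bar> < e})"
    have "open N"
      unfolding N_def using h(2)
    proof (intro open_INT ballI)
      fix b
      have "continuous_on UNIV (\<lambda>h :: 'b \<Rightarrow> real. \<bar>h b - m b\<bar>)"
        by (intro continuous_intros continuous_on_product_coordinates)
      then show "open {h :: 'b \<Rightarrow> real. \<bar>h b - m b\<bar> < e}"
        by (intro open_Collect_less continuous_on_const)
    qed
    moreover have "m \<in> N" using h(3) by (simp add: N_def)
    ultimately have "eventually (\<lambda>h. h \<in> N) (nhds m)" by (rule eventually_nhds_in_open)
    moreover have "eventually (\<lambda>h. h \<notin> N) (filtermap f \<F>)"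
      unfolding eventually_filtermap using h(1) by (rule eventually_mono) (use no in \<open>auto simp: N_def\<close>)
    ultimately have "eventually (\<lambda>_. False) (inf (nhds m) (filtermap f \<F>))"
      unfolding eventually_inf by blast
    then show False using m by (simp add: trivial_limit_def)
  qed
  then show ?thesis by blast
qed

context homeo_system
begin

text \<open>For an independence set \<open>J \<subseteq> F\<close> of proportional size, choose for each colouring \<open>\<sigma>\<close> of \<open>J\<close> a point
  \<open>x \<sigma>\<close> that realizes it.\<close>
definition coloured_sample ::
    "nat \<Rightarrow> (nat \<Rightarrow> 'x set) \<Rightarrow> 'g set \<Rightarrow> 'g set \<Rightarrow> (('g \<Rightarrow> nat) \<Rightarrow> 'x) \<Rightarrow> bool" where
  "coloured_sample k A F J x \<longleftrightarrow> finite F \<and> F \<noteq> {} \<and> F \<subseteq> carrier G \<and> J \<subseteq> F \<and>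
     indep_density k A * real (card F) \<le> real (card J) \<and>
     (\<forall>\<sigma>\<in>J \<rightarrow>\<^sub>E {1..k}. x \<sigma> \<in> topspace X \<and> (\<forall>s\<in>J. \<alpha> s (x \<sigma>) \<in> A (\<sigma> s)))"

text \<open>The distribution of the point \<open>\<alpha> s (x \<sigma>)\<close> for uniformly random \<open>s\<close> and \<open>\<sigma>\<close>. The randomness of \<open>\<sigma>\<close> is
  what makes a set of nearly full mass see almost all colourings at once.\<close>
definition empirical ::
    "nat \<Rightarrow> 'g set \<Rightarrow> 'g set \<Rightarrow> (('g \<Rightarrow> nat) \<Rightarrow> 'x) \<Rightarrow> 'x set \<Rightarrow> real" where
  "empirical k F J x B = real (card {(s, \<sigma>) \<in> F \<times> (J \<rightarrow>\<^sub>E {1..k}). \<alpha> s (x \<sigma>) \<in> B}) /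
     real (card (F \<times> (J \<rightarrow>\<^sub>E {1..k})))"

lemma coloured_sample_exists:
  assumes "finite F" "F \<noteq> {}" "F \<subseteq> carrier G"
  shows "\<exists>J x. coloured_sample k A F J x"
proof -
  obtain J where J: "J \<subseteq> F" "indep_set G X \<alpha> k A (topspace X) J"
      "card J = max_indep G X \<alpha> k A (topspace X) F"
    using max_indep_attained[OF assms(1)] .
  have "\<exists>y. y \<in> topspace X \<and> (\<forall>s\<in>J. \<alpha> s y \<in> A (\<sigma> s))" if \<sigma>: "\<sigma> \<in> J \<rightarrow>\<^sub>E {1..k}" for \<sigma>
  proof (cases "J = {}")
    case True
    moreover obtain y where "y \<in> topspace X" using nonempty by blast
    ultimately show ?thesis by blast
  next
    case False
    have "finite J" using J(1) assms(1) by (rule finite_subset)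
    moreover have "\<sigma> \<in> J \<rightarrow> {1..k}" using \<sigma> by (simp add: PiE_def)
    ultimately have "topspace X \<inter> (\<Inter>s\<in>J. {x \<in> topspace X. \<alpha> s x \<in> A (\<sigma> s)}) \<noteq> {}"
      using J(2) False unfolding indep_set_def by blast
    then show ?thesis by blast
  qed
  then obtain x where "\<And>\<sigma>. \<sigma> \<in> J \<rightarrow>\<^sub>E {1..k} \<Longrightarrow> x \<sigma> \<in> topspace X \<and> (\<forall>s\<in>J. \<alpha> s (x \<sigma>) \<in> A (\<sigma> s))"
    by metis
  moreover have "indep_density k A * real (card F) \<le> real (card J)"
    using indep_density_le[OF assms, of k A] J(3) assms by (simp add: pos_le_divide_eq card_gt_0_iff)
  ultimately show ?thesis using assms J(1) unfolding coloured_sample_def by blast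
qed

context
  fixes k :: nat and A :: "nat \<Rightarrow> 'x set" and F J :: "'g set" and x :: "('g \<Rightarrow> nat) \<Rightarrow> 'x"
  assumes k: "k \<ge> 1" and sample: "coloured_sample k A F J x"
begin

private abbreviation "cols \<equiv> J \<rightarrow>\<^sub>E {1..k}"

lemma sample_facts:
  shows "finite F" "F \<noteq> {}" "F \<subseteq> carrier G" "J \<subseteq> F" "finite J"
    "indep_density k A * real (card F) \<le> real (card J)"
    "finite cols" "card cols = k ^ card J" "0 < card (F \<times> cols)"
    "\<And>\<sigma>. \<sigma> \<in> cols \<Longrightarrow> x \<sigma> \<in> topspace X"
    "\<And>\<sigma> s. \<sigma> \<in> cols \<Longrightarrow> s \<in> J \<Longrightarrow> \<alpha> s (x \<sigma>) \<in> A (\<sigma> s)"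
proof -
  show 1: "finite F" "F \<noteq> {}" "F \<subseteq> carrier G" "J \<subseteq> F"
    "indep_density k A * real (card F) \<le> real (card J)"
    "\<And>\<sigma>. \<sigma> \<in> cols \<Longrightarrow> x \<sigma> \<in> topspace X"
    "\<And>\<sigma> s. \<sigma> \<in> cols \<Longrightarrow> s \<in> J \<Longrightarrow> \<alpha> s (x \<sigma>) \<in> A (\<sigma> s)"
    using sample by (auto simp: coloured_sample_def)
  show 2: "finite J" using 1 finite_subset by blast
  show 3: "finite cols" using 2 by (intro finite_PiE) auto
  show 4: "card cols = k ^ card J" using 2 by (simp add: card_PiE)
  show "0 < card (F \<times> cols)" using 1 4 k by (simp add: card_cartesian_product card_gt_0_iff)
qed

lemma finite_pairs: "finite {(s, \<sigma>) \<in> F \<times> cols. Q s \<sigma>}"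
  by (rule finite_subset[of _ "F \<times> cols"]) (use sample_facts in auto)

lemma empirical_fin_add_prob: "fin_add_prob (topspace X) (empirical k F J x)"
proof
  show "0 \<le> empirical k F J x B" for B by (simp add: empirical_def)
  have "{(s, \<sigma>) \<in> F \<times> cols. \<alpha> s (x \<sigma>) \<in> topspace X} = F \<times> cols"
    using sample_facts act_closed by blast
  then show "empirical k F J x (topspace X) = 1"
    unfolding empirical_def using sample_facts(9) by simp
  fix B C :: "'x set" assume "B \<inter> C = {}"
  then have "card ({(s, \<sigma>) \<in> F \<times> cols. \<alpha> s (x \<sigma>) \<in> B} \<union> {(s, \<sigma>) \<in> F \<times> cols. \<alpha> s (x \<sigma>) \<in> C})
    = card {(s, \<sigma>) \<in> F \<times> cols. \<alpha> s (x \<sigma>) \<in> B} + card {(s, \<sigma>) \<in> F \<times> cols. \<alpha> s (x \<sigma>) \<in> C}"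
    by (intro card_Un_disjoint finite_pairs) auto
  moreover have "{(s, \<sigma>) \<in> F \<times> cols. \<alpha> s (x \<sigma>) \<in> B \<union> C} =
      {(s, \<sigma>) \<in> F \<times> cols. \<alpha> s (x \<sigma>) \<in> B} \<union> {(s, \<sigma>) \<in> F \<times> cols. \<alpha> s (x \<sigma>) \<in> C}"
    by auto
  ultimately show "empirical k F J x (B \<union> C) = empirical k F J x B + empirical k F J x C"
    unfolding empirical_def by (simp add: add_divide_distrib)
qed

text \<open>Moving by \<open>g\<close> replaces \<open>s\<close> by \<open>g \<otimes> s\<close>, which stays in \<open>F\<close> for most \<open>s\<close>. An upper bound is enough,
  as it can be applied to complements.\<close>
lemma empirical_translate_le:
  assumes F: "F \<in> inv_sets G K \<delta>" and g: "g \<in> K" "K \<subseteq> carrier G"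
  shows "empirical k F J x {y \<in> topspace X. \<alpha> g y \<in> B} \<le> empirical k F J x B + \<delta>"
proof -
  have gG: "g \<in> carrier G" using g by blast
  define F0 where "F0 = {s \<in> F. g \<otimes> s \<in> F}"
  have finF: "finite F" and FG: "F \<subseteq> carrier G" using sample_facts by auto
  have F0F: "F0 \<subseteq> F" by (auto simp: F0_def)
  have "card {s \<in> F. K #> s \<subseteq> F} \<le> card F0"
    using finF g by (intro card_mono) (auto simp: F0_def r_coset_def)
  moreover have "(1 - \<delta>) * real (card F) \<le> real (card {s \<in> F. K #> s \<subseteq> F})"
    using F by (simp add: inv_sets_def)
  ultimately have "(1 - \<delta>) * real (card F) \<le> real (card F0)" by linarith
  then have rest: "real (card (F - F0)) \<le> \<delta> * real (card F)"
    using card_Diff_subset[of F0 F] finite_subset[OF F0F finF] F0F card_mono[OF finF F0F]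
    by (simp add: of_nat_diff algebra_simps)
  let ?P = "\<lambda>B. {(s, \<sigma>) \<in> F \<times> cols. \<alpha> s (x \<sigma>) \<in> B}"
  let ?Q = "{(s, \<sigma>) \<in> F0 \<times> cols. \<alpha> (g \<otimes> s) (x \<sigma>) \<in> B}"
  have sub: "?P {y \<in> topspace X. \<alpha> g y \<in> B} \<subseteq> ?Q \<union> (F - F0) \<times> cols"
  proof
    fix p assume "p \<in> ?P {y \<in> topspace X. \<alpha> g y \<in> B}"
    then obtain s \<sigma> where p: "p = (s, \<sigma>)" "s \<in> F" "\<sigma> \<in> cols" "\<alpha> g (\<alpha> s (x \<sigma>)) \<in> B" by auto
    moreover have "\<alpha> g (\<alpha> s (x \<sigma>)) = \<alpha> (g \<otimes> s) (x \<sigma>)"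
      using p gG FG sample_facts(10) by (intro act_mult) auto
    ultimately show "p \<in> ?Q \<union> (F - F0) \<times> cols" by auto
  qed
  have finQ: "finite ?Q"
    by (rule finite_subset[of _ "F \<times> cols"]) (use sample_facts F0F in auto)
  have "card ?Q \<le> card (?P B)"
  proof (rule card_inj_on_le[where f = "\<lambda>(s, \<sigma>). (g \<otimes> s, \<sigma>)"])
    show "inj_on (\<lambda>(s, \<sigma>). (g \<otimes> s, \<sigma>)) ?Q"
    proof (rule inj_onI)
      fix p q assume pq: "p \<in> ?Q" "q \<in> ?Q" "(\<lambda>(s, \<sigma>). (g \<otimes> s, \<sigma>)) p = (\<lambda>(s, \<sigma>). (g \<otimes> s, \<sigma>)) q"
      obtain s \<sigma> t \<tau> where eq: "p = (s, \<sigma>)" "q = (t, \<tau>)" by (metis surj_pair)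
      have st: "s \<in> F0" "t \<in> F0" "g \<otimes> s = g \<otimes> t" "\<sigma> = \<tau>"
        using pq unfolding eq by simp_all
      then have "s \<in> carrier G" "t \<in> carrier G" using F0F FG by (meson subsetD)+
      then have "s = t" using gG st(3) Units_l_cancel[of g s t] Units_eq by metis
      then show "p = q" using eq st(4) by simp
    qed
    show "(\<lambda>(s, \<sigma>). (g \<otimes> s, \<sigma>)) ` ?Q \<subseteq> ?P B"
    proof (rule image_subsetI)
      fix p assume p: "p \<in> ?Q"
      obtain s \<sigma> where eq: "p = (s, \<sigma>)" by (metis surj_pair)
      show "(\<lambda>(s, \<sigma>). (g \<otimes> s, \<sigma>)) p \<in> ?P B"
        using p unfolding eq F0_def by (simp del: PiE_iff)
    qed
  qed (rule finite_pairs)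
  moreover have "card (?P {y \<in> topspace X. \<alpha> g y \<in> B}) \<le> card (?Q \<union> (F - F0) \<times> cols)"
    using sub finQ finF sample_facts(7) by (intro card_mono) auto
  moreover have "card (?Q \<union> (F - F0) \<times> cols) \<le> card ?Q + card (F - F0) * card cols"
    using card_Un_le[of ?Q "(F - F0) \<times> cols"] by (simp add: card_cartesian_product)
  ultimately have "card (?P {y \<in> topspace X. \<alpha> g y \<in> B}) \<le> card (?P B) + card (F - F0) * card cols"
    by linarith
  then have "real (card (?P {y \<in> topspace X. \<alpha> g y \<in> B})) \<le> real (card (?P B)) + real (card (F - F0)) * real (card cols)"
    by (simp only: of_nat_le_iff flip: of_nat_add of_nat_mult)
  also have "\<dots> \<le> real (card (?P B)) + \<delta> * real (card F) * real (card cols)"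
    using rest by (intro add_left_mono mult_right_mono) auto
  also have "\<dots> = real (card (?P B)) + \<delta> * real (card (F \<times> cols))"
    by (simp add: card_cartesian_product)
  finally show ?thesis
    unfolding empirical_def using sample_facts(9) by (simp add: field_simps)
qed

text \<open>Two averages over \<open>s \<in> F\<close> are combined. Since \<open>V\<close> has nearly full mass, \<open>\<alpha> s (x \<sigma>)\<close> lies in \<open>V\<close> for
  nearly all colourings \<open>\<sigma>\<close>, except for a proportion at most \<open>L / 8\<close> of bad \<open>s\<close>. On the other hand the
  translates of \<open>E\<close> meet \<open>J\<close> in a proportion of at least \<open>3 * L / 4\<close> on average, and the bad \<open>s\<close> cannot
  account for that much, so some \<open>s\<close> is good in both respects.\<close>
lemma many_good_translates:
  assumes L: "indep_density k A = L" "L > 0"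
    and E: "finite E" "E \<noteq> {}" "E \<subseteq> carrier G"
    and F: "F \<in> inv_sets G ((\<lambda>t. inv t) ` E) (L / 4)"
    and V: "empirical k F J x V \<ge> 1 - L / (16 * real k)"
  shows "\<exists>s\<in>F. real (card {t \<in> E. t \<otimes> s \<in> J}) \<ge> L / 2 * real (card E) \<and>
    real (card {\<sigma> \<in> cols. \<alpha> s (x \<sigma>) \<in> V}) \<ge> (1 - 1 / (2 * real k)) * real (card cols)"
proof (rule ccontr)
  assume no: "\<not> ?thesis"
  define q where "q s = real (card {\<sigma> \<in> cols. \<alpha> s (x \<sigma>) \<in> V})" for s
  define h where "h s = real (card {t \<in> E. t \<otimes> s \<in> J})" for s
  define N where "N = real (card cols)"
  define f where "f = real (card F)"
  define e where "e = real (card E)"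
  have finF: "finite F" and FG: "F \<subseteq> carrier G" and JF: "J \<subseteq> F" using sample_facts by auto
  have pos: "N > 0" "f > 0" "e > 0"
    using sample_facts k E by (auto simp: N_def f_def e_def card_gt_0_iff)
  have kk: "real k \<ge> 1" using k by simp
  define Bad where "Bad = {s \<in> F. q s < (1 - 1 / (2 * real k)) * N}"
  define b where "b = real (card Bad)"
  have BF: "Bad \<subseteq> F" by (auto simp: Bad_def)
  have finB: "finite Bad" using BF finF by (rule finite_subset)
  have cardF: "f = real (card (F - Bad)) + b"
    using card_Diff_subset[OF finB BF] card_mono[OF finF BF] by (simp add: f_def b_def of_nat_diff)
  have split: "(\<Sum>s\<in>F. u s) = (\<Sum>s\<in>F - Bad. u s) + (\<Sum>s\<in>Bad. u s)" for u :: "'g \<Rightarrow> real"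
    using sum.subset_diff[OF BF finF] .
  \<comment> \<open>first average: by Markov's inequality few elements are bad\<close>
  have "{(s, \<sigma>) \<in> F \<times> cols. \<alpha> s (x \<sigma>) \<in> V} = (SIGMA s:F. {\<sigma> \<in> cols. \<alpha> s (x \<sigma>) \<in> V})" by auto
  then have "real (card {(s, \<sigma>) \<in> F \<times> cols. \<alpha> s (x \<sigma>) \<in> V}) = (\<Sum>s\<in>F. q s)"
    using finF sample_facts(7) by (simp add: q_def)
  then have "empirical k F J x V = (\<Sum>s\<in>F. q s) / (f * N)"
    by (simp add: empirical_def f_def N_def card_cartesian_product)
  then have qsum: "(\<Sum>s\<in>F. q s) \<ge> (1 - L / (16 * real k)) * (f * N)"
    using V pos by (simp add: pos_le_divide_eq)
  have "q s \<le> N" for s unfolding q_def N_def using sample_facts(7) by (intro of_nat_mono card_mono) auto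
  then have "(\<Sum>s\<in>F. q s) \<le> (\<Sum>s\<in>F - Bad. N) + (\<Sum>s\<in>Bad. (1 - 1 / (2 * real k)) * N)"
    unfolding split by (intro add_mono sum_mono) (auto simp: Bad_def)
  also have "\<dots> = (f - b / (2 * real k)) * N"
    using cardF by (simp add: b_def algebra_simps)
  finally have "(1 - L / (16 * real k)) * f * N \<le> (f - b / (2 * real k)) * N" using qsum by simp
  then have "(1 - L / (16 * real k)) * f \<le> f - b / (2 * real k)" using pos by simp
  then have bad: "b \<le> L / 8 * f" using kk by (simp add: field_simps)
  \<comment> \<open>second average: count the pairs \<open>(t, s)\<close> with \<open>t \<otimes> s \<in> J\<close>, for each \<open>t\<close> separately\<close>
  define core where "core = {s \<in> F. (\<lambda>t. inv t) ` E #> s \<subseteq> F}"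
  have cF: "core \<subseteq> F" and finc: "finite core" using finF by (auto simp: core_def)
  have core: "real (card core) \<ge> (1 - L / 4) * f" using F by (simp add: inv_sets_def core_def f_def)
  have "real (card {s \<in> F. t \<otimes> s \<in> J}) \<ge> 3 * L / 4 * f" if t: "t \<in> E" for t
  proof -
    have tG: "t \<in> carrier G" using t E by blast
    have "card (J \<inter> core) \<le> card {s \<in> F. t \<otimes> s \<in> J}"
    proof (rule card_inj_on_le[where f = "\<lambda>u. inv t \<otimes> u"])
      show "inj_on (\<lambda>u. inv t \<otimes> u) (J \<inter> core)"
        using tG JF FG by (auto simp: inj_on_def subset_iff)
      show "(\<lambda>u. inv t \<otimes> u) ` (J \<inter> core) \<subseteq> {s \<in> F. t \<otimes> s \<in> J}"
      proof (rule image_subsetI)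
        fix u assume u: "u \<in> J \<inter> core"
        then have "u \<in> carrier G" using JF FG by blast
        then have "t \<otimes> (inv t \<otimes> u) = u" using tG by (simp add: m_assoc[symmetric])
        moreover have "inv t \<otimes> u \<in> F" using u t by (auto simp: core_def r_coset_def)
        ultimately show "inv t \<otimes> u \<in> {s \<in> F. t \<otimes> s \<in> J}" using u by simp
      qed
    qed (use finF in simp)
    moreover have "card J + card core \<le> card (J \<inter> core) + card F"
      using card_Un_Int[OF sample_facts(5) finc] card_mono[OF finF, of "J \<union> core"] JF cF by simp
    ultimately have "real (card J) + real (card core) \<le> real (card {s \<in> F. t \<otimes> s \<in> J}) + f"
      unfolding f_def by linarith
    then show ?thesis using core sample_facts(6) L(1) unfolding f_def[symmetric]
      by (simp add: algebra_simps)
  qed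
  then have "(\<Sum>t\<in>E. 3 * L / 4 * f) \<le> (\<Sum>t\<in>E. real (card {s \<in> F. t \<otimes> s \<in> J}))"
    by (intro sum_mono)
  also have "\<dots> = (\<Sum>s\<in>F. h s)"
    using sum.swap_restrict[OF E(1) finF, of "\<lambda>_ _. 1::real" "\<lambda>t s. t \<otimes> s \<in> J"] by (simp add: h_def)
  finally have hlow: "3 * L / 4 * f * e \<le> (\<Sum>s\<in>F. h s)" by (simp add: e_def mult.commute)
  have "h s \<le> e" for s unfolding h_def e_def using E by (intro of_nat_mono card_mono) auto
  moreover have "h s \<le> L / 2 * e" if "s \<in> F - Bad" for s
    using no that by (force simp: h_def e_def q_def N_def Bad_def not_less)
  ultimately have "(\<Sum>s\<in>F. h s) \<le> (\<Sum>s\<in>F - Bad. L / 2 * e) + (\<Sum>s\<in>Bad. e)"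
    unfolding split by (intro add_mono sum_mono) auto
  also have "\<dots> = (f - b) * (L / 2 * e) + b * e" using cardF by (simp add: b_def)
  also have "\<dots> \<le> f * (L / 2 * e) + L / 8 * f * e"
    using bad pos L by (intro add_mono mult_right_mono) (auto simp: b_def)
  finally have "3 * L / 4 * f * e \<le> 5 * L / 8 * f * e" using hlow by (simp add: field_simps)
  moreover have "L * f * e > 0" using pos L by simp
  ultimately show False by (simp add: field_simps)
qed

text \<open>For \<open>s\<close> as above the colourings \<open>\<sigma>\<close> with \<open>\<alpha> s (x \<sigma>) \<in> V\<close> are so many that they shatter a
  subset \<open>J0\<close> of \<open>J\<close> in the translate of \<open>E\<close> by \<open>s\<close> that is not small. Translating \<open>J0\<close> back into \<open>E\<close> gives
  an independence set relative to \<open>V\<close>, realized by the points \<open>\<alpha> s (x \<sigma>)\<close> themselves.\<close>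
lemma indep_subset_of_sample:
  assumes L: "indep_density k A = L" "L > 0"
    and E: "finite E" "E \<noteq> {}" "E \<subseteq> carrier G"
    and F: "F \<in> inv_sets G ((\<lambda>t. inv t) ` E) (L / 4)"
    and V: "empirical k F J x V \<ge> 1 - L / (16 * real k)"
  shows "\<exists>J'\<subseteq>E. indep_set G X \<alpha> k A V J' \<and> real (card J') \<ge> shatter_density k * (L / 2) * real (card E)"
proof -
  obtain s where s: "s \<in> F" "real (card {t \<in> E. t \<otimes> s \<in> J}) \<ge> L / 2 * real (card E)"
    "real (card {\<sigma> \<in> cols. \<alpha> s (x \<sigma>) \<in> V}) \<ge> (1 - 1 / (2 * real k)) * real (card cols)"
    using many_good_translates[OF assms] by blast
  have sG: "s \<in> carrier G" using s sample_facts(3) by blast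
  define I where "I = (\<lambda>t. t \<otimes> s) ` {t \<in> E. t \<otimes> s \<in> J}"
  have inj: "inj_on (\<lambda>t. t \<otimes> s) E" using E sG by (auto simp: inj_on_def subset_iff)
  have IJ: "I \<subseteq> J" by (auto simp: I_def)
  have finI: "finite I" using E by (simp add: I_def)
  have cI: "card I = card {t \<in> E. t \<otimes> s \<in> J}"
    unfolding I_def by (intro card_image inj_on_subset[OF inj]) auto
  define S0 where "S0 = {\<sigma> \<in> cols. \<alpha> s (x \<sigma>) \<in> V}"
  define S where "S = (\<lambda>\<sigma>. restrict \<sigma> I) ` S0"
  have S: "S \<subseteq> I \<rightarrow>\<^sub>E {1..k}" using IJ by (auto simp: S_def S0_def)
  have "card S0 \<le> card S * card {1..k} ^ card (J - I)"
    unfolding S_def using IJ sample_facts(5) by (intro card_le_card_restrict_image) (auto simp: S0_def)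
  then have "real (card S0) \<le> real (card S) * real k ^ card (J - I)"
    by (metis card_atLeastAtMost diff_Suc_1 of_nat_le_iff of_nat_mult of_nat_power)
  moreover have "real (card cols) = real k ^ card I * real k ^ card (J - I)"
  proof -
    have "card J = card I + card (J - I)"
      using card_Diff_subset[OF finI IJ] card_mono[OF sample_facts(5) IJ] by simp
    then show ?thesis unfolding sample_facts(8) by (simp add: power_add)
  qed
  ultimately have "(1 - 1 / (2 * real k)) * real k ^ card I * real k ^ card (J - I)
      \<le> real (card S) * real k ^ card (J - I)"
    using s(3) by (simp add: S0_def mult.assoc)
  then have "real (card S) \<ge> (1 - 1 / (2 * real (card {1..k}))) * real (card {1..k}) ^ card I"
    using k by simp
  from large_shattered_subset[OF finI _ _ S this] k
  obtain J0 where J0: "J0 \<subseteq> I" "shatters S {1..k} J0"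
      "real (card J0) \<ge> shatter_density k * real (card I)"
    by auto
  define J' where "J' = {t \<in> E. t \<otimes> s \<in> J0}"
  have "J0 = (\<lambda>t. t \<otimes> s) ` J'" using J0(1) by (auto simp: J'_def I_def)
  moreover have "inj_on (\<lambda>t. t \<otimes> s) J'" by (rule inj_on_subset[OF inj]) (simp add: J'_def)
  ultimately have "card J0 = card J'" by (simp add: card_image)
  then have "real (card J') \<ge> shatter_density k * (L / 2 * real (card E))"
    using order_trans[OF mult_left_mono[OF s(2), of "shatter_density k"] J0(3)[unfolded cI]]
      shatter_density_pos[OF k] by simp
  moreover have "indep_set G X \<alpha> k A V J'"
    unfolding indep_set_def
  proof (intro conjI allI impI)
    show "J' \<subseteq> carrier G" using E by (auto simp: J'_def)
    fix F' \<sigma>' assume F': "finite F' \<and> F' \<noteq> {} \<and> F' \<subseteq> J' \<and> \<sigma>' \<in> F' \<rightarrow> {1..k}"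
    define \<tau> where "\<tau> = (\<lambda>u\<in>J0. if u \<otimes> inv s \<in> F' then \<sigma>' (u \<otimes> inv s) else 1)"
    have "(if u \<in> F' then \<sigma>' u else 1) \<in> {1..k}" for u
      using F' k by (cases "u \<in> F'") auto
    then have "\<tau> \<in> J0 \<rightarrow>\<^sub>E {1..k}" unfolding \<tau>_def by (intro restrict_PiE_iff[THEN iffD2] ballI)
    then obtain \<sigma> where \<sigma>: "\<sigma> \<in> S0" "restrict (restrict \<sigma> I) J0 = \<tau>"
      using J0(2) by (auto simp: shatters_def S_def)
    have \<sigma>c: "\<sigma> \<in> cols" using \<sigma>(1) by (simp add: S0_def)
    have y: "\<alpha> s (x \<sigma>) \<in> topspace X" "\<alpha> s (x \<sigma>) \<in> V"
      using \<sigma>(1) sample_facts(10)[OF \<sigma>c] act_closed[OF sG] by (auto simp: S0_def)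
    have "\<alpha> t (\<alpha> s (x \<sigma>)) \<in> A (\<sigma>' t)" if t: "t \<in> F'" for t
    proof -
      have t': "t \<in> E" "t \<otimes> s \<in> J0" "t \<in> carrier G" using t F' E by (auto simp: J'_def)
      then have "t \<otimes> s \<in> J" using J0(1) IJ by blast
      then have "\<alpha> (t \<otimes> s) (x \<sigma>) \<in> A (\<sigma> (t \<otimes> s))" using sample_facts(11)[OF \<sigma>c] by blast
      moreover have "\<sigma> (t \<otimes> s) = \<tau> (t \<otimes> s)"
        using \<sigma>(2) t' J0(1) by (auto simp flip: \<sigma>(2))
      moreover have "\<tau> (t \<otimes> s) = \<sigma>' t"
        using t t' sG by (simp add: \<tau>_def m_assoc)
      ultimately show ?thesis using act_mult[OF t'(3) sG sample_facts(10)[OF \<sigma>c]] by simp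
    qed
    then have "\<alpha> s (x \<sigma>) \<in> V \<inter> (\<Inter>t\<in>F'. {x \<in> topspace X. \<alpha> t x \<in> A (\<sigma>' t)})" using y by blast
    then show "V \<inter> (\<Inter>t\<in>F'. {x \<in> topspace X. \<alpha> t x \<in> A (\<sigma>' t)}) \<noteq> {}" by blast
  qed
  ultimately show ?thesis by (intro exI[of _ J']) (auto simp: J'_def mult.assoc)
qed

end

definition invariant_mean :: "('x set \<Rightarrow> real) \<Rightarrow> bool" where
  "invariant_mean m \<longleftrightarrow> fin_add_prob (topspace X) m \<and>
     (\<forall>g\<in>carrier G. \<forall>B\<subseteq>topspace X. m {x \<in> topspace X. \<alpha> g x \<in> B} = m B)"

text \<open>The finitely additive counterpart of positive upper density relative to large sets, required for
  all finite \<open>E\<close> rather than asymptotically.\<close>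
definition detects_indep :: "('x set \<Rightarrow> real) \<Rightarrow> nat \<Rightarrow> (nat \<Rightarrow> 'x set) \<Rightarrow> bool" where
  "detects_indep m k A \<longleftrightarrow> (\<exists>\<beta>>0. \<exists>c>0. \<forall>V\<subseteq>topspace X. m V \<ge> 1 - \<beta> \<longrightarrow>
     (\<forall>E. finite E \<and> E \<noteq> {} \<and> E \<subseteq> carrier G \<longrightarrow>
        (\<exists>J\<subseteq>E. indep_set G X \<alpha> k A V J \<and> real (card J) \<ge> c * real (card E))))"

text \<open>The mean is a cluster point of the empirical distributions along ever more invariant sets. Finite
  additivity and invariance are conditions on finitely many values, hence pass to the cluster point;
  and for given \<open>V\<close> and \<open>E\<close>, one sufficiently invariant empirical distribution that is close to the mean
  at \<open>V\<close> already provides the independence set.\<close>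
theorem exists_mean_detecting_indep:
  assumes "folner G" and k: "k \<ge> 1"
  shows "\<exists>m. invariant_mean m \<and> (indep_density k A > 0 \<longrightarrow> detects_indep m k A)"
proof -
  have "\<exists>F J x. p \<in> inv_params G \<longrightarrow> F \<in> inv_sets G (fst p) (snd p) \<and> coloured_sample k A F J x" for p
  proof (cases "p \<in> inv_params G")
    case True
    then obtain F where "F \<in> inv_sets G (fst p) (snd p)" using folnerD[OF assms(1)] by blast
    moreover from this obtain J x where "coloured_sample k A F J x"
      using coloured_sample_exists[of F k A] by (auto simp: inv_sets_def)
    ultimately show ?thesis by blast
  qed auto
  then obtain F J x where sm: "\<And>p. p \<in> inv_params G \<Longrightarrow>
      F p \<in> inv_sets G (fst p) (snd p) \<and> coloured_sample k A (F p) (J p) (x p)"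
    by metis
  \<comment> \<open>values outside the space and outside the directed set are chosen to stay in the unit interval\<close>
  define \<mu> where "\<mu> p B = empirical k (F p) (J p) (x p) (B \<inter> topspace X)" for p B
  define f where "f p B = (if p \<in> inv_params G then \<mu> p B else 0)" for p B
  have fp: "fin_add_prob (topspace X) (\<mu> p)" if "p \<in> inv_params G" for p
  proof -
    interpret e: fin_add_prob "topspace X" "empirical k (F p) (J p) (x p)"
      using sm[OF that] by (intro empirical_fin_add_prob[OF k]) auto
    show ?thesis
      by unfold_locales (auto simp: \<mu>_def e.nonneg e.total Int_Un_distrib2 Int_absorb2 intro!: e.add)
  qed
  have "f p B \<in> {0..1}" for p B
  proof (cases "p \<in> inv_params G")
    case True
    then interpret e: fin_add_prob "topspace X" "\<mu> p" by (rule fp)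
    have "\<mu> p B = \<mu> p (B \<inter> topspace X)" by (simp add: \<mu>_def)
    then show ?thesis using True e.nonneg[of "B \<inter> topspace X"] e.le_1[of "B \<inter> topspace X"]
      by (simp add: f_def)
  qed (simp add: f_def)
  from cluster_point_unit_interval[of "inv_net G" f, OF inv_net_neq_bot this]
  obtain m where m: "\<And>P \<B> e. eventually P (inv_net G) \<Longrightarrow> finite \<B> \<Longrightarrow> e > 0 \<Longrightarrow>
      \<exists>p. P p \<and> (\<forall>b\<in>\<B>. \<bar>f p b - m b\<bar> < e)"
    by metis
  have near: "\<exists>K' \<delta>'. (K', \<delta>') \<in> inv_params G \<and> K \<subseteq> K' \<and> \<delta>' \<le> \<delta> \<and> (\<forall>B\<in>\<B>. \<bar>\<mu> (K', \<delta>') B - m B\<bar> < e)"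
    if h: "(K, \<delta>) \<in> inv_params G" "finite \<B>" "e > 0" for K \<delta> \<B> e
  proof -
    have "eventually (\<lambda>p. p \<in> inv_params G \<and> K \<subseteq> fst p \<and> snd p \<le> \<delta>) (inv_net G)"
      unfolding eventually_inv_net using h(1) by auto
    from m[OF this h(2,3)] obtain p where "p \<in> inv_params G" "K \<subseteq> fst p" "snd p \<le> \<delta>"
        "\<forall>b\<in>\<B>. \<bar>f p b - m b\<bar> < e"
      by blast
    then show ?thesis by (intro exI[of _ "fst p"] exI[of _ "snd p"]) (simp add: f_def)
  qed
  interpret m: fin_add_prob "topspace X" m
  proof
    fix B assume B: "B \<subseteq> topspace X"
    show "0 \<le> m B"
    proof (rule field_le_epsilon)
      fix e :: real assume "0 < e"
      from near[OF inv_params_nonempty _ this, of "{B}"] obtain p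
        where p: "p \<in> inv_params G" "\<bar>\<mu> p B - m B\<bar> < e" by auto
      then show "0 \<le> m B + e" using fin_add_prob.nonneg[OF fp[OF p(1)] B] by linarith
    qed
  next
    have "\<bar>1 - m (topspace X)\<bar> \<le> 0 + e" if "0 < e" for e
    proof -
      from near[OF inv_params_nonempty _ that, of "{topspace X}"] obtain p
        where p: "p \<in> inv_params G" "\<bar>\<mu> p (topspace X) - m (topspace X)\<bar> < e" by auto
      then show ?thesis using fin_add_prob.total[OF fp[OF p(1)]] by linarith
    qed
    then have "\<bar>1 - m (topspace X)\<bar> \<le> 0" by (rule field_le_epsilon)
    then show "m (topspace X) = 1" by simp
  next
    fix B C assume B: "B \<subseteq> topspace X" "C \<subseteq> topspace X" "B \<inter> C = {}"
    have "\<bar>m (B \<union> C) - (m B + m C)\<bar> \<le> 0 + e" if "0 < e" for e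
    proof -
      have "e / 3 > 0" using that by simp
      from near[OF inv_params_nonempty _ this, of "{B, C, B \<union> C}"] obtain p
        where p: "p \<in> inv_params G" "\<bar>\<mu> p B - m B\<bar> < e / 3" "\<bar>\<mu> p C - m C\<bar> < e / 3"
          "\<bar>\<mu> p (B \<union> C) - m (B \<union> C)\<bar> < e / 3"
        by auto
      then show ?thesis using fin_add_prob.add[OF fp[OF p(1)] B] by linarith
    qed
    then have "\<bar>m (B \<union> C) - (m B + m C)\<bar> \<le> 0" by (rule field_le_epsilon)
    then show "m (B \<union> C) = m B + m C" by simp
  qed
  have inv_le: "m {x \<in> topspace X. \<alpha> g x \<in> B} \<le> m B" if g: "g \<in> carrier G" and B: "B \<subseteq> topspace X" for g B
  proof (rule field_le_epsilon)
    fix e :: real assume e: "0 < e"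
    let ?B = "{x \<in> topspace X. \<alpha> g x \<in> B}"
    have par: "({g}, e / 3) \<in> inv_params G" using e g by (simp add: inv_params_def)
    have e3: "e / 3 > 0" using e by simp
    from near[OF par _ e3, of "{B, ?B}"] obtain K \<delta> where p: "(K, \<delta>) \<in> inv_params G" "g \<in> K"
        "\<delta> \<le> e / 3" "\<bar>\<mu> (K, \<delta>) B - m B\<bar> < e / 3" "\<bar>\<mu> (K, \<delta>) ?B - m ?B\<bar> < e / 3"
      by auto
    have "\<mu> (K, \<delta>) ?B \<le> \<mu> (K, \<delta>) B + \<delta>"
    proof -
      have "?B \<inter> topspace X = ?B" "B \<inter> topspace X = B" using B by auto
      then show ?thesis
        unfolding \<mu>_def using p(1,2) sm[OF p(1)]
        by (simp only:) (rule empirical_translate_le[OF k, where K = K], auto simp: inv_params_def)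
    qed
    then show "m ?B \<le> m B + e" using p by linarith
  qed
  have "m {x \<in> topspace X. \<alpha> g x \<in> B} = m B" if g: "g \<in> carrier G" and B: "B \<subseteq> topspace X" for g B
  proof (rule antisym[OF inv_le[OF g B]])
    have "{x \<in> topspace X. \<alpha> g x \<in> topspace X - B} = topspace X - {x \<in> topspace X. \<alpha> g x \<in> B}"
      using act_closed[OF g] by auto
    then have "m (topspace X - {x \<in> topspace X. \<alpha> g x \<in> B}) \<le> m (topspace X - B)"
      using inv_le[OF g, of "topspace X - B"] by simp
    then show "m B \<le> m {x \<in> topspace X. \<alpha> g x \<in> B}"
      using m.Compl[OF B] m.Compl[of "{x \<in> topspace X. \<alpha> g x \<in> B}"] by auto
  qed
  then have "invariant_mean m" unfolding invariant_mean_def using m.fin_add_prob_axioms by blast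
  moreover have "detects_indep m k A" if L: "indep_density k A > 0"
  proof -
    define L where "L = indep_density k A"
    have L0: "indep_density k A = L" "L > 0" using L by (simp_all add: L_def)
    \<comment> \<open>half of the defect that is tolerable for an empirical distribution; the other half is spent on
      the approximation\<close>
    define b where "b = L / (32 * real k)"
    have b: "b > 0" using L0 k by (simp add: b_def)
    have "\<exists>J\<subseteq>E. indep_set G X \<alpha> k A V J \<and> real (card J) \<ge> shatter_density k * (L / 2) * real (card E)"
      if V: "V \<subseteq> topspace X" "m V \<ge> 1 - b" and E: "finite E" "E \<noteq> {}" "E \<subseteq> carrier G" for V E
    proof -
      have par: "((\<lambda>t. inv t) ` E, L / 4) \<in> inv_params G"
        using E L0 by (auto simp: inv_params_def)
      from near[OF par _ b, of "{V}"] obtain K \<delta> where p: "(K, \<delta>) \<in> inv_params G"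
          "(\<lambda>t. inv t) ` E \<subseteq> K" "\<delta> \<le> L / 4" "\<bar>\<mu> (K, \<delta>) V - m V\<bar> < b"
        by auto
      have "V \<inter> topspace X = V" using V by auto
      then have "empirical k (F (K, \<delta>)) (J (K, \<delta>)) (x (K, \<delta>)) V \<ge> 1 - 2 * b"
        using p(4) V(2) by (simp add: \<mu>_def)
      moreover have "2 * b = L / (16 * real k)" by (simp add: b_def)
      moreover have "F (K, \<delta>) \<in> inv_sets G ((\<lambda>t. inv t) ` E) (L / 4)"
        using sm[OF p(1)] inv_sets_anti_mono[OF p(2,3)] by auto
      ultimately show ?thesis
        using sm[OF p(1)] by (intro indep_subset_of_sample[OF k _ L0 E]) auto
    qed
    moreover have "shatter_density k * (L / 2) > 0" using shatter_density_pos[OF k] L0 by simp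
    ultimately show ?thesis unfolding detects_indep_def using b by blast
  qed
  ultimately show ?thesis by blast
qed

end

section \<open>Measures whose IE-tuples are the topological ones\<close>

text \<open>Closed balls with centres in finite nets. They serve to replace the uncountably many product
  neighbourhoods by countably many tuples of closed sets.\<close>
lemma compact_metrizable_closed_base:
  assumes "compact_space X" "metrizable_space X" "topspace X \<noteq> {}"
  shows "\<exists>B :: nat \<Rightarrow> 'x set. (\<forall>n. closedin X (B n)) \<and>
    (\<forall>x V. openin X V \<and> x \<in> V \<longrightarrow> (\<exists>n W. openin X W \<and> x \<in> W \<and> W \<subseteq> B n \<and> B n \<subseteq> V))"
proof -
  obtain M d where "Metric_space M d" and X: "X = Metric_space.mtopology M d"
    using assms(2) by (auto simp: metrizable_space_def)
  interpret Metric_space M d by fact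
  have top: "topspace X = M" by (simp add: X)
  have "mtotally_bounded M"
    using assms(1) by (simp add: X compactin_imp_mtotally_bounded compact_space_def)
  then have "\<exists>K. finite K \<and> K \<subseteq> M \<and> M \<subseteq> (\<Union>x\<in>K. mball x (1 / real (Suc n)))" for n
    unfolding mtotally_bounded_def by simp
  then obtain K where K: "\<And>n. finite (K n)" "\<And>n. K n \<subseteq> M"
      "\<And>n. M \<subseteq> (\<Union>x\<in>K n. mball x (1 / real (Suc n)))"
    by metis
  define \<B> where "\<B> = (\<Union>n. (\<lambda>y. mcball y (1 / real (Suc n))) ` K n)"
  have cnt: "countable \<B>" unfolding \<B>_def using K(1) by (intro countable_UN countable_image) (auto intro: countable_finite)
  have "K 0 \<noteq> {}" using K(3)[of 0] assms(3) top by auto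
  then have ne: "\<B> \<noteq> {}" by (auto simp: \<B>_def)
  define B where "B = from_nat_into \<B>"
  have rB: "range B = \<B>" unfolding B_def by (rule range_from_nat_into[OF ne cnt])
  have "closedin X (B n)" for n
  proof -
    have "B n \<in> \<B>" using rB by blast
    then show ?thesis by (auto simp: \<B>_def X)
  qed
  moreover have "\<exists>n W. openin X W \<and> x \<in> W \<and> W \<subseteq> B n \<and> B n \<subseteq> V"
    if V: "openin X V" "x \<in> V" for x V
  proof -
    obtain r where r: "r > 0" "mball x r \<subseteq> V" and VM: "V \<subseteq> M"
      using V unfolding X openin_mtopology by blast
    obtain n where n: "2 / r < real n" using reals_Archimedean2 by blast
    have "x \<in> M" using V VM by blast
    then obtain y where y: "y \<in> K n" "x \<in> mball y (1 / real (Suc n))" using K(3)[of n] by blast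
    have yM: "y \<in> M" using y K(2) by blast
    have "2 / real (Suc n) < r"
    proof -
      have "2 < r * real n" using n r by (simp add: field_simps)
      also have "\<dots> \<le> r * real (Suc n)" using r by (intro mult_left_mono) auto
      finally show ?thesis by (simp add: pos_divide_less_eq)
    qed
    then have small: "1 / real (Suc n) + 1 / real (Suc n) < r" by simp
    have "mcball y (1 / real (Suc n)) \<subseteq> mball x r"
    proof
      fix z assume z: "z \<in> mcball y (1 / real (Suc n))"
      then have "z \<in> M" "d y z \<le> 1 / real (Suc n)" by (auto simp: in_mcball)
      moreover have "d x y < 1 / real (Suc n)" using y(2) by (simp add: in_mball commute)
      moreover have "d x z \<le> d x y + d y z" using \<open>x \<in> M\<close> yM \<open>z \<in> M\<close> by (rule triangle)
      ultimately show "z \<in> mball x r" using small \<open>x \<in> M\<close> by (simp add: in_mball)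
    qed
    moreover have "mcball y (1 / real (Suc n)) \<in> \<B>" using y(1) by (auto simp: \<B>_def)
    then obtain j where "B j = mcball y (1 / real (Suc n))" using rB by (metis imageE)
    moreover have "mball y (1 / real (Suc n)) \<subseteq> mcball y (1 / real (Suc n))" by (rule mball_subset_mcball)
    moreover have "openin X (mball y (1 / real (Suc n)))" by (simp add: X)
    ultimately show ?thesis using r(2) y(2) by (metis order_trans)
  qed
  ultimately show ?thesis by blast
qed

context homeo_system
begin

definition mixture :: "(nat \<Rightarrow> 'x set \<Rightarrow> real) \<Rightarrow> 'x set \<Rightarrow> real" where
  "mixture m B = (\<Sum>n. (1/2) ^ Suc n * m n B)"

lemma mixture_sums:
  assumes "\<And>n. invariant_mean (m n)" "B \<subseteq> topspace X"
  shows "(\<lambda>n. (1/2) ^ Suc n * m n B) sums mixture m B"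
  unfolding mixture_def
proof (rule summable_sums, rule summable_comparison_test')
  show "summable (\<lambda>n. (1/2 :: real) ^ Suc n)" using power_half_series sums_summable by blast
  fix n :: nat
  interpret fin_add_prob "topspace X" "m n" using assms(1) by (simp add: invariant_mean_def)
  show "norm ((1/2) ^ Suc n * m n B) \<le> (1/2) ^ Suc n"
    using nonneg[OF assms(2)] le_1[OF assms(2)] by (simp add: abs_mult mult_left_le)
qed

lemma invariant_mean_mixture:
  assumes m: "\<And>n. invariant_mean (m n)"
  shows "invariant_mean (mixture m)"
  unfolding invariant_mean_def
proof (intro conjI ballI allI impI)
  have f: "fin_add_prob (topspace X) (m n)" for n using m by (simp add: invariant_mean_def)
  show "fin_add_prob (topspace X) (mixture m)"
  proof
    show "0 \<le> mixture m B" if "B \<subseteq> topspace X" for B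
      by (rule sums_le[OF _ sums_zero mixture_sums[OF m that]])
        (simp add: fin_add_prob.nonneg[OF f that])
    show "mixture m (topspace X) = 1"
      using mixture_sums[OF m order_refl] power_half_series sums_unique2
      by (fastforce simp: fin_add_prob.total[OF f])
    show "mixture m (B \<union> C) = mixture m B + mixture m C"
      if "B \<subseteq> topspace X" "C \<subseteq> topspace X" "B \<inter> C = {}" for B C
    proof -
      have "(\<lambda>n. (1/2) ^ Suc n * m n (B \<union> C)) sums (mixture m B + mixture m C)"
        using sums_add[OF mixture_sums[of m, OF m that(1)] mixture_sums[of m, OF m that(2)]]
        by (simp only: fin_add_prob.add[OF f that] distrib_left)
      moreover have "(\<lambda>n. (1/2) ^ Suc n * m n (B \<union> C)) sums mixture m (B \<union> C)"
        using that by (intro mixture_sums m) auto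
      ultimately show ?thesis by (rule sums_unique2[THEN sym])
    qed
  qed
  show "mixture m {x \<in> topspace X. \<alpha> g x \<in> B} = mixture m B"
    if "g \<in> carrier G" "B \<subseteq> topspace X" for g B
    using m that by (simp add: mixture_def invariant_mean_def)
qed

text \<open>All weights are positive, so a set of nearly full mass for the mixture has nearly full mass for
  each component, where the tolerance depends on the component.\<close>
lemma detects_indep_mixture:
  assumes m: "\<And>n. invariant_mean (m n)" and d: "detects_indep (m n) k A"
  shows "detects_indep (mixture m) k A"
proof -
  interpret mix: fin_add_prob "topspace X" "mixture m"
    using invariant_mean_mixture[OF m] by (simp add: invariant_mean_def)
  interpret n: fin_add_prob "topspace X" "m n" using m by (simp add: invariant_mean_def)
  obtain \<beta> c where bc: "\<beta> > 0" "c > 0" "\<And>V E. V \<subseteq> topspace X \<Longrightarrow> m n V \<ge> 1 - \<beta> \<Longrightarrow>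
      finite E \<and> E \<noteq> {} \<and> E \<subseteq> carrier G \<Longrightarrow>
        \<exists>J\<subseteq>E. indep_set G X \<alpha> k A V J \<and> real (card J) \<ge> c * real (card E)"
    using d unfolding detects_indep_def by metis
  have "m n V \<ge> 1 - \<beta>" if V: "V \<subseteq> topspace X" "mixture m V \<ge> 1 - (1/2) ^ Suc n * \<beta>" for V
  proof -
    have "(\<Sum>j\<in>{n}. (1/2) ^ Suc j * m j (topspace X - V)) \<le> mixture m (topspace X - V)"
      unfolding mixture_def
    proof (rule sum_le_suminf[OF sums_summable[OF mixture_sums[of m, OF m]]])
      show "0 \<le> (1/2) ^ Suc j * m j (topspace X - V)" for j
        using m[of j] fin_add_prob.nonneg[of "topspace X" "m j" "topspace X - V"]
        by (simp add: invariant_mean_def)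
    qed auto
    also have "\<dots> \<le> (1/2) ^ Suc n * \<beta>" using V mix.Compl[OF V(1)] by simp
    finally have "(1/2) ^ Suc n * m n (topspace X - V) \<le> (1/2) ^ Suc n * \<beta>" by simp
    then have "m n (topspace X - V) \<le> \<beta>" by simp
    then show ?thesis using n.Compl[OF V(1)] by simp
  qed
  then show ?thesis
    unfolding detects_indep_def using bc(1,2)
    by (intro exI[of _ "(1/2) ^ Suc n * \<beta>"] exI[of _ c] conjI allI impI bc(3)) auto
qed

text \<open>Only finitely many \<open>J \<subseteq> E\<close> are candidates. If each of them failed for the closed set \<open>C\<close>, then for
  each of them some pattern would have a closed set of realizations disjoint from \<open>C\<close>; the complement of
  these finitely many closed sets would be a neighbourhood of \<open>C\<close> relative to which none of the
  candidates is independent.\<close>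
lemma indep_from_neighbourhoods:
  assumes A: "\<And>i. i \<in> {1..k} \<Longrightarrow> closedin X (A i)" and C: "closedin X C"
    and E: "finite E" "E \<subseteq> carrier G"
    and nbhd: "\<And>V. openin X V \<Longrightarrow> C \<subseteq> V \<Longrightarrow> \<exists>J\<subseteq>E. indep_set G X \<alpha> k A V J \<and> Q J"
  shows "\<exists>J\<subseteq>E. indep_set G X \<alpha> k A C J \<and> Q J"
proof (rule ccontr)
  assume no: "\<not> ?thesis"
  define \<J> where "\<J> = {J. J \<subseteq> E \<and> Q J}"
  define Z where "Z F \<sigma> = (\<Inter>s\<in>F. {x \<in> topspace X. \<alpha> s x \<in> A (\<sigma> s)})" for F and \<sigma> :: "'g \<Rightarrow> nat"
  have "\<exists>F \<sigma>. finite F \<and> F \<noteq> {} \<and> F \<subseteq> J \<and> \<sigma> \<in> F \<rightarrow> {1..k} \<and> C \<inter> Z F \<sigma> = {}" if "J \<in> \<J>" for J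
  proof -
    have "\<not> indep_set G X \<alpha> k A C J" using that no by (auto simp: \<J>_def)
    moreover have "J \<subseteq> carrier G" using that E by (auto simp: \<J>_def)
    ultimately show ?thesis unfolding indep_set_def Z_def by blast
  qed
  then obtain F \<sigma> where F: "\<And>J. J \<in> \<J> \<Longrightarrow> finite (F J) \<and> F J \<noteq> {} \<and> F J \<subseteq> J \<and> \<sigma> J \<in> F J \<rightarrow> {1..k}"
      "\<And>J. J \<in> \<J> \<Longrightarrow> C \<inter> Z (F J) (\<sigma> J) = {}"
    by metis
  have "closedin X (Z (F J) (\<sigma> J))" if J: "J \<in> \<J>" for J
    unfolding Z_def
  proof (rule closedin_INT)
    fix s assume s: "s \<in> F J"
    then have "s \<in> carrier G" using F(1)[OF J] J E by (auto simp: \<J>_def)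
    then have "continuous_map X X (\<alpha> s)"
      using homeo_action by (auto simp: homeo_action_def intro: homeomorphic_imp_continuous_map)
    moreover have "closedin X (A (\<sigma> J s))" using F(1)[OF J] s by (intro A) auto
    ultimately show "closedin X {x \<in> topspace X. \<alpha> s x \<in> A (\<sigma> J s)}"
      by (rule closedin_continuous_map_preimage)
  qed (use F(1)[OF J] in blast)
  moreover have "finite \<J>" using E by (simp add: \<J>_def)
  ultimately have "closedin X (\<Union>J\<in>\<J>. Z (F J) (\<sigma> J))" by (intro closedin_Union) auto
  then have "openin X (topspace X - (\<Union>J\<in>\<J>. Z (F J) (\<sigma> J)))" by blast
  moreover have "C \<subseteq> topspace X - (\<Union>J\<in>\<J>. Z (F J) (\<sigma> J))"
    using F(2) closedin_subset[OF C] by blast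
  ultimately obtain J where J: "J \<subseteq> E" "Q J"
      "indep_set G X \<alpha> k A (topspace X - (\<Union>J\<in>\<J>. Z (F J) (\<sigma> J))) J"
    using nbhd by blast
  then have JJ: "J \<in> \<J>" by (simp add: \<J>_def)
  then have "(topspace X - (\<Union>J\<in>\<J>. Z (F J) (\<sigma> J))) \<inter> Z (F J) (\<sigma> J) \<noteq> {}"
    using J(3) F(1)[OF JJ] unfolding indep_set_def Z_def by blast
  then show False using JJ by blast
qed

lemma large_sets_image_finite:
  "finite F \<Longrightarrow> finite ((\<lambda>D. max_indep G X \<alpha> k A D F) ` large_sets \<mu> \<delta>)"
  by (rule finite_subset[of _ "{..card F}"]) (auto intro: max_indep_le_card)

lemma topspace_in_large_sets:
  assumes "invariant_borel_prob G X \<alpha> \<mu>" "\<delta> > 0"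
  shows "topspace X \<in> large_sets \<mu> \<delta>"
proof -
  interpret prob_space \<mu> using assms by (simp add: invariant_borel_prob_def)
  have "sets \<mu> = sets (borel_of X)" using assms by (simp add: invariant_borel_prob_def)
  then have "space \<mu> = topspace X"
    using sets_eq_imp_space_eq[of \<mu> "borel_of X"] openin_subset[of X] by (simp add: borel_of_def subset_iff)
  then show ?thesis using assms(2) sets.top[of \<mu>] prob_space by (simp add: large_sets_def)
qed

text \<open>Independence relative to the whole space is the weakest condition, so it bounds the minimum over
  large sets from above.\<close>
lemma mu_IE_subset_IE:
  assumes fol: "folner G" and \<mu>: "invariant_borel_prob G X \<alpha> \<mu>"
  shows "mu_IE_tuples G X \<alpha> \<mu> k \<subseteq> IE_tuples G X \<alpha> k"
proof
  fix x assume x: "x \<in> mu_IE_tuples G X \<alpha> \<mu> k"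
  have "\<exists>L>0. has_inv_limit G (\<lambda>F. real (max_indep G X \<alpha> k U (topspace X) F)) L"
    if U: "product_nbhd X k x U" for U
  proof -
    have "upper_mu_density G X \<alpha> \<mu> k U > 0" using x U by (simp add: mu_IE_tuples_def)
    then obtain \<delta> where \<delta>: "\<delta> > 0" "inv_limsup G (\<lambda>F. real (mu_indep G X \<alpha> \<mu> k U \<delta> F)) > 0"
      unfolding upper_mu_density_def upper_mu_density_at_def less_SUP_iff by auto
    have "inv_limsup G (\<lambda>F. real (mu_indep G X \<alpha> \<mu> k U \<delta> F))
        \<le> inv_limsup G (\<lambda>F. real (max_indep G X \<alpha> k U (topspace X) F))"
    proof (rule inv_limsup_mono)
      fix F :: "'g set" assume "finite F"
      then show "real (mu_indep G X \<alpha> \<mu> k U \<delta> F) \<le> real (max_indep G X \<alpha> k U (topspace X) F)"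
        unfolding mu_indep_def using topspace_in_large_sets[OF \<mu> \<delta>(1)]
        by (intro of_nat_mono Min_le large_sets_image_finite imageI)
    qed
    moreover have lim: "has_inv_limit G (\<lambda>F. real (max_indep G X \<alpha> k U (topspace X) F)) (ereal (indep_density k U))"
      by (rule max_indep_has_inv_limit[OF fol])
    ultimately have "ereal (indep_density k U) > 0" using \<delta>(2) by (metis has_inv_limit_def less_le_trans)
    then show ?thesis using lim by blast
  qed
  then show "x \<in> IE_tuples G X \<alpha> k" using x by (simp add: IE_tuples_def mu_IE_tuples_def)
qed

end

locale compact_homeo_system = homeo_system G X \<alpha>
  for G :: "('g, 'b) monoid_scheme" (structure) and X :: "'x topology" and \<alpha> +
  assumes compact: "compact_space X" and metrizable: "metrizable_space X"
begin

lemma mean_on_compact: "invariant_mean m \<Longrightarrow> fin_add_prob_on_compact X m"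
  using compact metrizable
  by (intro fin_add_prob_on_compact.intro fin_add_prob_on_compact_axioms.intro
      metrizable_imp_normal_space) (auto simp: invariant_mean_def)

lemma invariant_borel_prob_regular_measure:
  assumes m: "invariant_mean m"
  shows "invariant_borel_prob G X \<alpha> (fin_add_prob_on_compact.regular_measure X m)"
proof -
  interpret m: fin_add_prob_on_compact X m using m by (rule mean_on_compact)
  show ?thesis
    using m by (intro m.invariant_regular_measure homeo_action group_axioms)
      (auto simp: invariant_mean_def)
qed

text \<open>A Borel set of large measure contains a closed set whose neighbourhoods are large for \<open>m\<close>, and
  independence relative to these neighbourhoods passes to the closed set.\<close>
lemma upper_mu_density_pos:
  assumes fol: "folner G" and m: "invariant_mean m"
    and det: "detects_indep m k A"
    and A: "\<And>i. i \<in> {1..k} \<Longrightarrow> closedin X (A i)" and U: "\<And>i. i \<in> {1..k} \<Longrightarrow> A i \<subseteq> U i"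
  shows "upper_mu_density G X \<alpha> (fin_add_prob_on_compact.regular_measure X m) k U > 0"
proof -
  interpret m: fin_add_prob_on_compact X m using m by (rule mean_on_compact)
  let ?\<mu> = m.regular_measure
  have inv: "invariant_borel_prob G X \<alpha> ?\<mu>"
    using m by (rule invariant_borel_prob_regular_measure)
  obtain \<beta> c where bc: "\<beta> > 0" "c > 0" "\<And>V E. V \<subseteq> topspace X \<Longrightarrow> m V \<ge> 1 - \<beta> \<Longrightarrow>
      finite E \<and> E \<noteq> {} \<and> E \<subseteq> carrier G \<Longrightarrow>
        \<exists>J\<subseteq>E. indep_set G X \<alpha> k A V J \<and> real (card J) \<ge> c * real (card E)"
    using det unfolding detects_indep_def by metis
  have b2: "\<beta> / 2 > 0" using bc by simp
  have "c * real (card E) \<le> real (mu_indep G X \<alpha> ?\<mu> k U (\<beta> / 2) E)"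
    if E: "finite E" "E \<noteq> {}" "E \<subseteq> carrier G" for E
  proof -
    have "c * real (card E) \<le> real (max_indep G X \<alpha> k U D E)" if D: "D \<in> large_sets ?\<mu> (\<beta> / 2)" for D
    proof -
      have D': "D \<in> sets ?\<mu>" "measure ?\<mu> D \<ge> 1 - \<beta> / 2" using D by (auto simp: large_sets_def)
      obtain C where C: "closedin X C" "C \<subseteq> D"
          "\<And>V. openin X V \<Longrightarrow> C \<subseteq> V \<Longrightarrow> m V \<ge> measure ?\<mu> D - \<beta> / 2"
        using m.closed_inside[OF D'(1) b2] by blast
      have "\<exists>J\<subseteq>E. indep_set G X \<alpha> k A C J \<and> c * real (card E) \<le> real (card J)"
      proof (rule indep_from_neighbourhoods[OF A C(1) E(1,3)])
        fix V assume V: "openin X V" "C \<subseteq> V"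
        have "m V \<ge> 1 - \<beta>" using C(3)[OF V] D'(2) by simp
        then show "\<exists>J\<subseteq>E. indep_set G X \<alpha> k A V J \<and> c * real (card E) \<le> real (card J)"
          using bc(3)[OF openin_subset[OF V(1)]] E by blast
      qed
      then obtain J where J: "J \<subseteq> E" "indep_set G X \<alpha> k A C J" "c * real (card E) \<le> real (card J)" by blast
      have "card J \<le> max_indep G X \<alpha> k U D E"
        using max_indep_ge[OF E(1) indep_mono[OF J(2) U C(2)]] J(1) by (simp add: Int_absorb1)
      then show ?thesis using J(3) by linarith
    qed
    moreover have "mu_indep G X \<alpha> ?\<mu> k U (\<beta> / 2) E \<in> (\<lambda>D. max_indep G X \<alpha> k U D E) ` large_sets ?\<mu> (\<beta> / 2)"
      unfolding mu_indep_def using topspace_in_large_sets[OF inv b2]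
      by (intro Min_in large_sets_image_finite E(1)) blast
    ultimately show ?thesis by auto
  qed
  then have "ereal c \<le> upper_mu_density_at G X \<alpha> ?\<mu> k U (\<beta> / 2)"
    unfolding upper_mu_density_at_def by (rule inv_limsup_ge[OF fol])
  also have "\<dots> \<le> upper_mu_density G X \<alpha> ?\<mu> k U"
    unfolding upper_mu_density_def using b2 by (intro SUP_upper) auto
  finally show ?thesis using bc(2) by (meson ereal_less(2) order_less_le_trans)
qed

text \<open>Mix the means that belong to all tuples of sets from the closed base. The code \<open>n\<close> of a list of
  indices stands for the tuple of the sets with these indices; the empty list is
  read as a tuple of length \<open>1\<close>. Every product neighbourhood of an IE-tuple contains one of these tuples
  that is again a product neighbourhood, and therefore has positive density.\<close>
lemma exists_measure_if_folner:
  assumes fol: "folner G"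
  shows "\<exists>\<mu>. invariant_borel_prob G X \<alpha> \<mu> \<and>
           (\<forall>k\<ge>1. mu_IE_tuples G X \<alpha> \<mu> k = IE_tuples G X \<alpha> k)"
proof -
  obtain B :: "nat \<Rightarrow> 'x set" where B: "\<And>n. closedin X (B n)"
      "\<And>x V. openin X V \<Longrightarrow> x \<in> V \<Longrightarrow> \<exists>n W. openin X W \<and> x \<in> W \<and> W \<subseteq> B n \<and> B n \<subseteq> V"
    using compact_metrizable_closed_base[OF compact metrizable nonempty] by metis
  define len where "len n = max 1 (length (from_nat n :: nat list))" for n
  define A where "A n i = B ((from_nat n :: nat list) ! (i - 1))" for n i
  have "\<exists>m. invariant_mean m \<and> (indep_density (len n) (A n) > 0 \<longrightarrow> detects_indep m (len n) (A n))" for n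
    by (rule exists_mean_detecting_indep[OF fol]) (simp add: len_def)
  then obtain m where m: "\<And>n. invariant_mean (m n)"
      "\<And>n. indep_density (len n) (A n) > 0 \<Longrightarrow> detects_indep (m n) (len n) (A n)"
    by metis
  have mix: "invariant_mean (mixture m)" using m(1) by (rule invariant_mean_mixture)
  let ?\<mu> = "fin_add_prob_on_compact.regular_measure X (mixture m)"
  have inv: "invariant_borel_prob G X \<alpha> ?\<mu>"
    using mix by (rule invariant_borel_prob_regular_measure)
  have "IE_tuples G X \<alpha> k \<subseteq> mu_IE_tuples G X \<alpha> ?\<mu> k" if k: "k \<ge> 1" for k
  proof
    fix x assume x: "x \<in> IE_tuples G X \<alpha> k"
    have "upper_mu_density G X \<alpha> ?\<mu> k U > 0" if U: "product_nbhd X k x U" for U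
    proof -
      have "\<exists>n W. openin X W \<and> x i \<in> W \<and> W \<subseteq> B n \<and> B n \<subseteq> U i" if i: "i \<in> {1..k}" for i
      proof -
        obtain V where "openin X V" "x i \<in> V" "V \<subseteq> U i" using U i unfolding product_nbhd_def by blast
        then show ?thesis using B(2) by (meson order_trans)
      qed
      then obtain c where c: "\<And>i. i \<in> {1..k} \<Longrightarrow> \<exists>W. openin X W \<and> x i \<in> W \<and> W \<subseteq> B (c i) \<and> B (c i) \<subseteq> U i"
        by metis
      define n where "n = to_nat (map c [1..<Suc k])"
      have len: "len n = k" using k by (simp add: len_def n_def)
      have A: "A n i = B (c i)" if "i \<in> {1..k}" for i
        using that by (auto simp add: A_def n_def simp del: upt_Suc)
      have "product_nbhd X k x (A n)"
        unfolding product_nbhd_def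
      proof
        fix i assume i: "i \<in> {1..k}"
        show "A n i \<subseteq> topspace X \<and> (\<exists>V. openin X V \<and> x i \<in> V \<and> V \<subseteq> A n i)"
          using c[OF i] closedin_subset[OF B(1)] unfolding A[OF i] by blast
      qed
      then obtain L where L: "L > 0" "has_inv_limit G (\<lambda>F. real (max_indep G X \<alpha> k (A n) (topspace X) F)) L"
        using x by (auto simp: IE_tuples_def)
      have "ereal (indep_density k (A n)) = L"
        using L(2) max_indep_has_inv_limit[OF fol, of k "A n"] by (simp add: has_inv_limit_def)
      then have "indep_density (len n) (A n) > 0" using L(1) len by (metis ereal_less(2))
      from detects_indep_mixture[of m, OF m(1) m(2)[OF this]]
      have "detects_indep (mixture m) k (A n)" unfolding len .
      then show ?thesis
      proof (rule upper_mu_density_pos[OF fol mix])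
        fix i assume i: "i \<in> {1..k}"
        show "closedin X (A n i)" using B(1) by (simp add: A_def)
        show "A n i \<subseteq> U i" using c[OF i] unfolding A[OF i] by blast
      qed
    qed
    then show "x \<in> mu_IE_tuples G X \<alpha> ?\<mu> k" using x by (simp add: IE_tuples_def mu_IE_tuples_def)
  qed
  then show ?thesis using inv mu_IE_subset_IE[OF fol inv] by blast
qed

text \<open>Transport the invariant mean of the group along an orbit.\<close>
lemma orbit_mean:
  assumes "amenable G"
  shows "\<exists>m. invariant_mean m"
proof -
  from assms obtain M :: "'g set \<Rightarrow> real" where M':
      "\<forall>A. A \<subseteq> carrier G \<longrightarrow> 0 \<le> M A" "M (carrier G) = 1"
      "\<forall>A B. A \<subseteq> carrier G \<and> B \<subseteq> carrier G \<and> A \<inter> B = {} \<longrightarrow> M (A \<union> B) = M A + M B"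
      "\<forall>g A. g \<in> carrier G \<and> A \<subseteq> carrier G \<longrightarrow> M (g <# A) = M A"
    unfolding amenable_def by (elim exE conjE) (rule that)
  have M: "\<And>S. S \<subseteq> carrier G \<Longrightarrow> 0 \<le> M S" "M (carrier G) = 1"
      "\<And>S T. S \<subseteq> carrier G \<Longrightarrow> T \<subseteq> carrier G \<Longrightarrow> S \<inter> T = {} \<Longrightarrow> M (S \<union> T) = M S + M T"
      "\<And>g S. g \<in> carrier G \<Longrightarrow> S \<subseteq> carrier G \<Longrightarrow> M (g <# S) = M S"
    using M' by simp_all
  obtain x where x: "x \<in> topspace X" using nonempty by blast
  define ret where "ret B = {g \<in> carrier G. \<alpha> g x \<in> B}" for B
  have ret: "ret B \<subseteq> carrier G" for B by (auto simp: ret_def)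
  have "fin_add_prob (topspace X) (\<lambda>B. M (ret B))"
  proof
    show "0 \<le> M (ret B)" for B using ret by (rule M(1))
    have "ret (topspace X) = carrier G" using act_closed x by (auto simp: ret_def)
    then show "M (ret (topspace X)) = 1" using M(2) by simp
    fix B C :: "'x set" assume "B \<inter> C = {}"
    then have "ret B \<inter> ret C = {}" "ret (B \<union> C) = ret B \<union> ret C" by (auto simp: ret_def)
    then show "M (ret (B \<union> C)) = M (ret B) + M (ret C)" using M(3)[OF ret ret] by simp
  qed
  moreover have "M (ret {y \<in> topspace X. \<alpha> g y \<in> B}) = M (ret B)" if g: "g \<in> carrier G" for g B
  proof -
    have "g <# ret {y \<in> topspace X. \<alpha> g y \<in> B} = ret B"
    proof (intro equalityI subsetI)
      fix h assume "h \<in> g <# ret {y \<in> topspace X. \<alpha> g y \<in> B}"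
      then show "h \<in> ret B" using g x act_mult by (auto simp: l_coset_def ret_def)
    next
      fix h assume h: "h \<in> ret B"
      then have hG: "h \<in> carrier G" by (simp add: ret_def)
      have eq: "h = g \<otimes> (inv g \<otimes> h)" using g hG by (simp add: m_assoc[symmetric])
      have "\<alpha> g (\<alpha> (inv g \<otimes> h) x) = \<alpha> h x"
        using g hG x eq act_mult[of g "inv g \<otimes> h" x] by simp
      then have "inv g \<otimes> h \<in> ret {y \<in> topspace X. \<alpha> g y \<in> B}"
        using h g hG x act_closed by (simp add: ret_def)
      then show "h \<in> g <# ret {y \<in> topspace X. \<alpha> g y \<in> B}"
        unfolding l_coset_def using eq by blast
    qed
    then show ?thesis using M(4)[OF g ret] by metis
  qed
  ultimately show ?thesis unfolding invariant_mean_def by blast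
qed

text \<open>Here the limit supremum of every function is \<open>-\<infinity>\<close>, and no density is positive.\<close>
lemma tuples_empty_not_folner:
  assumes "\<not> folner G"
  shows "IE_tuples G X \<alpha> k = {}" "mu_IE_tuples G X \<alpha> \<mu> k = {}"
proof -
  have nb: "product_nbhd X k x (\<lambda>_. topspace X)" if "x \<in> {1..k} \<rightarrow>\<^sub>E topspace X" for x
    using that by (auto simp: product_nbhd_def)
  show "IE_tuples G X \<alpha> k = {}"
    using nb by (force simp: IE_tuples_def has_inv_limit_def inv_limsup_not_folner[OF assms])
  have "upper_mu_density G X \<alpha> \<mu> k U \<le> -\<infinity>" for U
    unfolding upper_mu_density_def upper_mu_density_at_def
    by (rule SUP_least) (simp add: inv_limsup_not_folner[OF assms])
  then have "\<not> upper_mu_density G X \<alpha> \<mu> k U > 0" for U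
    by (metis ereal_infty_less_eq(2) ereal_less(6) less_asym)
  then show "mu_IE_tuples G X \<alpha> \<mu> k = {}" using nb by (force simp: mu_IE_tuples_def)
qed

end

theorem theorem2p23:
  fixes G :: "('g, 'b) monoid_scheme" and X :: "'x topology" and \<alpha> :: "'g \<Rightarrow> 'x \<Rightarrow> 'x"
  assumes "group G" and "amenable G"
    and "compact_space X" and "metrizable_space X" and "topspace X \<noteq> {}"
    and "homeo_action G X \<alpha>"
  shows "\<exists>\<mu>. invariant_borel_prob G X \<alpha> \<mu> \<and>
           (\<forall>k\<ge>1. mu_IE_tuples G X \<alpha> \<mu> k = IE_tuples G X \<alpha> k)"
proof -
  interpret compact_homeo_system G X \<alpha>
    using assms by (intro compact_homeo_system.intro homeo_system.intro
        homeo_system_axioms.intro compact_homeo_system_axioms.intro)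
  show ?thesis
  proof (cases "folner G")
    case True
    then show ?thesis by (rule exists_measure_if_folner)
  next
    case False
    obtain m where "invariant_mean m" using orbit_mean[OF assms(2)] by blast
    then have "invariant_borel_prob G X \<alpha> (fin_add_prob_on_compact.regular_measure X m)"
      by (rule invariant_borel_prob_regular_measure)
    then show ?thesis using tuples_empty_not_folner[OF False] by blast
  qed
qed

end
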